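(* Let $\Omega\subset\mathbb{R}^d$ be convex, and for each $\beta\ge 0$ let $Q_\beta$ be the transition kernel of an ergodic reversible Markov chain on $\Omega$ with stationary measure $\pi_\beta$. Let $S\subset\Omega$ be a fixed measurable set with $\inf_{\beta\ge 0}\pi_\beta(S)>0$, and for each $\beta\ge0$ let $G_\beta,B_\beta,W_\beta\subset S$ be measurable with $G_\beta\subset W_\beta$ and $B_\beta\subset W_\beta^{c}$. Assume that there exist $c>0$, functions $r_1,r_2$ bounded by a polynomial ($r_1$ taking positive integer values), and $\beta_0$ such that the following hold for all $\beta>\beta_0$: (1) (Small conductance) $\Phi_\beta(S)\le e^{-c\beta}$. (2) (Rapid mixing within $G_\beta$) $\displaystyle \sup_{x\in G_\beta}\big\|\hat Q_\beta^{\,r_1(\beta)}(x,\cdot)-\pi_\beta|_S(\cdot)\big\|_{\mathrm{TV}}\le \beta^{-2}\Phi_\beta(S)$. (3) (Never stuck in $W_\beta\setminus G_\beta$) $\displaystyle \sup_{x\in W_\beta\setminus G_\beta}\mathbb{P}\big[\tau_{x,\,G_\beta\cup S^c}>r_2(\beta)\big]\le\beta^{-2}\Phi_\beta(S)$. (4) (Never hitting $W_\beta^c$) $\displaystyle \sup_{x\in G_\beta}\mathbb{P}\big[\tau_{x,\,W_\beta^c}<\min(r_1(\beta)+r_2(\beta)+1,\ \tau_{x,S^c})\big]\le\Phi_\beta(S)^4$. Fix a point $x$ such that $x\in G_\beta$ for all sufficiently large $\beta$. Then for all $\epsilon>0$, $$\lim_{\beta\to\infty}\mathbb{P}\left[\frac{\log(\tau_{x,S^c})}{\log(\Phi_\beta(S)^{-1})}>1+\epsilon\right]=0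 .$$
   Context: Each $\pi_\beta$ is a probability measure on $\Omega$ with a smooth density. Complements are taken in $\Omega$. Conductance of a set: $\displaystyle \Phi_\beta(S)=\frac{\int_{S}Q_\beta(x,S^c)\,\pi_\beta(dx)}{\pi_\beta(S)}$. Restriction: $\pi_\beta|_S(A)=\pi_\beta(S\cap A)/\pi_\beta(S)$. $\hat Q_\beta$ is the Metropolis–Hastings kernel on $S$ with proposal kernel $Q_\beta$ and target distribution $\pi_\beta|_S$; since $Q_\beta$ is reversible with respect to $\pi_\beta$, this is the kernel which from $x\in S$ proposes $y\sim Q_\beta(x,\cdot)$, moves to $y$ if $y\in S$, and stays at $x$ otherwise, i.e. $\hat Q_\beta(x,A)=Q_\beta(x,A\cap S)+\mathbf 1_A(x)Q_\beta(x,S^c)$. Hitting time: for a Markov chain $\{X_t\}_{t\ge0}$ with kernel $Q_\beta$ and $X_0=x$, $\tau_{x,A}=\inf\{t\ge0: X_t\in A\}$ (the dependence on $\beta$ is suppressed). A nonnegative function $f$ is "bounded by a polynomial" if there are a polynomial $g$ and constants $0<C_1,C_2<\infty$ with $f(\beta)\le C_2\,g(\beta)$ for all $\beta>C_1$. $\|\cdot\|_{\mathrm{TV}}$ is total variation distance. *)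

theory Defs
  imports "HOL-Probability.Probability" "HOL-Computational_Algebra.Polynomial"
begin

section \<open>Smooth densities\<close>

text \<open>\<open>Ck k U f\<close>: \<open>f\<close> is \<open>k\<close> times continuously differentiable on \<open>U\<close>. Only meant for open \<open>U\<close>.\<close>

primrec Ck :: "nat \<Rightarrow> 'a::euclidean_space set \<Rightarrow> ('a \<Rightarrow> real) \<Rightarrow> bool" where
  "Ck 0 U f \<longleftrightarrow> continuous_on U f"
| "Ck (Suc k) U f \<longleftrightarrow> f differentiable_on U \<and>
     (\<forall>b\<in>Basis. Ck k U (\<lambda>x. frechet_derivative f (at x) b))"

definition smooth_on :: "'a::euclidean_space set \<Rightarrow> ('a \<Rightarrow> real) \<Rightarrow> bool" where
  "smooth_on U f \<longleftrightarrow> (\<forall>k. Ck k U f)"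

text \<open>
  A measure on the Borel sets of the subspace \<open>\<Omega>\<close>. The reference measure is \<open>lebesgue\<close>
  because a convex set need not be Borel, while it is always Lebesgue measurable. Its boundary is
  a Lebesgue null set, so that a density is determined by its values in the interior; smoothness
  is required there.
\<close>

definition has_smooth_density :: "'a::euclidean_space set \<Rightarrow> 'a measure \<Rightarrow> bool" where
  "has_smooth_density \<Omega> \<mu> \<longleftrightarrow>
     (\<exists>f. (\<forall>x\<in>\<Omega>. 0 \<le> f x) \<and> smooth_on (interior \<Omega>) f \<and>
       (\<forall>A\<in>sets (restrict_space borel \<Omega>).
          emeasure \<mu> A = (\<integral>\<^sup>+x\<in>A. ennreal (f x) \<partial>lebesgue)))"

section \<open>Markov kernels\<close>

definition markov_kernel :: "'a measure \<Rightarrow> ('a \<Rightarrow> 'a measure) \<Rightarrow> bool" where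
  "markov_kernel M K \<longleftrightarrow> K \<in> M \<rightarrow>\<^sub>M prob_algebra M"

definition stationary :: "('a \<Rightarrow> 'a measure) \<Rightarrow> 'a measure \<Rightarrow> bool" where
  "stationary K \<mu> \<longleftrightarrow> \<mu> \<bind> K = \<mu>"

definition reversible :: "('a \<Rightarrow> 'a measure) \<Rightarrow> 'a measure \<Rightarrow> bool" where
  "reversible K \<mu> \<longleftrightarrow>
     (\<forall>A\<in>sets \<mu>. \<forall>B\<in>sets \<mu>.
        (\<integral>\<^sup>+x\<in>A. emeasure (K x) B \<partial>\<mu>) = (\<integral>\<^sup>+x\<in>B. emeasure (K x) A \<partial>\<mu>))"

text \<open>
  Ergodicity of the stationary chain: almost surely invariant sets are trivial. This is implied by
  convergence in total variation of the chain to \<open>\<mu>\<close> from almost every starting point.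
\<close>

definition ergodic :: "('a \<Rightarrow> 'a measure) \<Rightarrow> 'a measure \<Rightarrow> bool" where
  "ergodic K \<mu> \<longleftrightarrow>
     (\<forall>A\<in>sets \<mu>. (AE x in \<mu>. measure (K x) A = indicator A x) \<longrightarrow>
        measure \<mu> A = 0 \<or> measure \<mu> A = 1)"

primrec kernel_power ::
  "'a measure \<Rightarrow> ('a \<Rightarrow> 'a measure) \<Rightarrow> nat \<Rightarrow> 'a \<Rightarrow> 'a measure" where
  "kernel_power M K 0 x = return M x"
| "kernel_power M K (Suc n) x = kernel_power M K n x \<bind> K"

definition conductance :: "('a \<Rightarrow> 'a measure) \<Rightarrow> 'a measure \<Rightarrow> 'a set \<Rightarrow> real" where
  "conductance K \<mu> S = (LINT x:S|\<mu>. measure (K x) (space \<mu> - S)) / measure \<mu> S"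

definition tv_dist :: "'a measure \<Rightarrow> 'a measure \<Rightarrow> real" where
  "tv_dist \<mu> \<nu> = (SUP A\<in>sets \<mu>. \<bar>measure \<mu> A - measure \<nu> A\<bar>)"

text \<open>
  The Metropolis-Hastings chain on \<open>S\<close> with proposal kernel \<open>K\<close> and target the restriction to \<open>S\<close>
  of a measure for which \<open>K\<close> is reversible: a proposal is accepted if and only if it lies in \<open>S\<close>.
  For \<open>x \<in> S\<close> the resulting measure is concentrated on \<open>S\<close>, but it is kept as a measure on the
  whole space \<open>M\<close>; likewise, the restriction of \<open>\<mu>\<close> to \<open>S\<close> is \<open>uniform_measure \<mu> S\<close>.
\<close>

definition mh_kernel ::
  "'a measure \<Rightarrow> ('a \<Rightarrow> 'a measure) \<Rightarrow> 'a set \<Rightarrow> 'a \<Rightarrow> 'a measure" where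
  "mh_kernel M K S x = distr (K x) M (\<lambda>y. if y \<in> S then y else x)"

lemma emeasure_mh_kernel:
  assumes K: "markov_kernel M K" and S: "S \<in> sets M" and x: "x \<in> space M" and A: "A \<in> sets M"
  shows "emeasure (mh_kernel M K S x) A =
           emeasure (K x) (A \<inter> S) + indicator A x * emeasure (K x) (space M - S)"
proof -
  have [measurable_cong, simp]: "sets (K x) = sets M"
    using measurable_space[OF K[unfolded markov_kernel_def] x] by (simp add: space_prob_algebra)
  have sp [simp]: "space (K x) = space M"
    by (rule sets_eq_imp_space_eq) simp
  note [measurable] = S A
  have "(\<lambda>y. if y \<in> S then y else x) \<in> K x \<rightarrow>\<^sub>M M"
    using x by measurable
  then have "emeasure (mh_kernel M K S x) A =
      emeasure (K x) ((\<lambda>y. if y \<in> S then y else x) -` A \<inter> space M)"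
    unfolding mh_kernel_def using A by (simp add: emeasure_distr)
  also have "(\<lambda>y. if y \<in> S then y else x) -` A \<inter> space M =
      (A \<inter> S) \<union> (if x \<in> A then space M - S else {})"
    using sets.sets_into_space[OF A] by (auto split: if_splits)
  also have "emeasure (K x) \<dots> =
      emeasure (K x) (A \<inter> S) + emeasure (K x) (if x \<in> A then space M - S else {})"
    by (rule plus_emeasure[symmetric]) (use S A in auto)
  also have "emeasure (K x) (if x \<in> A then space M - S else {}) =
      indicator A x * emeasure (K x) (space M - S)"
    by simp
  finally show ?thesis .
qed

section \<open>Paths and hitting times\<close>

text \<open>
  The law on path space \<open>PiM UNIV (\<lambda>_. M)\<close> of the Markov chain with kernel \<open>K\<close> started at \<open>x\<close>,
  obtained from the Ionescu-Tulcea theorem: coordinate \<open>0\<close> is drawn from \<open>return M x\<close>, and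
  coordinate \<open>n + 1\<close>, given the path up to time \<open>n\<close>, from \<open>K (\<omega> n)\<close>.
\<close>

definition chain_step ::
  "'a measure \<Rightarrow> ('a \<Rightarrow> 'a measure) \<Rightarrow> 'a \<Rightarrow> nat \<Rightarrow> (nat \<Rightarrow> 'a) \<Rightarrow> 'a measure" where
  "chain_step M K x i \<omega> = (case i of 0 \<Rightarrow> return M x | Suc n \<Rightarrow> K (\<omega> n))"

definition chain_law ::
  "'a measure \<Rightarrow> ('a \<Rightarrow> 'a measure) \<Rightarrow> 'a \<Rightarrow> (nat \<Rightarrow> 'a) measure" where
  "chain_law M K x =
     projective_family.lim UNIV (Ionescu_Tulcea.CI (chain_step M K x) (\<lambda>_. M)) (\<lambda>_. M)"

lemma Ionescu_Tulcea_chain_step: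
  assumes K: "markov_kernel M K" and x: "x \<in> space M"
  shows "Ionescu_Tulcea (chain_step M K x) (\<lambda>_. M)"
proof -
  note K' = K[unfolded markov_kernel_def]
  have 1: "chain_step M K x i \<in> PiM {0..<i} (\<lambda>_. M) \<rightarrow>\<^sub>M subprob_algebra M" for i
  proof (cases i)
    case 0
    then show ?thesis
      using measurable_space[OF return_measurable x] by (simp add: chain_step_def[abs_def])
  next
    case (Suc n)
    have "(\<lambda>\<omega>. \<omega> n) \<in> PiM {0..<i} (\<lambda>_. M) \<rightarrow>\<^sub>M M"
      using Suc by (intro measurable_component_singleton) auto
    from measurable_compose[OF this measurable_prob_algebraD[OF K']] show ?thesis
      using Suc by (simp add: chain_step_def[abs_def])
  qed
  have 2: "prob_space (chain_step M K x i \<omega>)" if "\<omega> \<in> space (PiM {0..<i} (\<lambda>_. M))" for i \<omega>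
  proof (cases i)
    case 0
    then show ?thesis using x by (simp add: chain_step_def prob_space_return)
  next
    case (Suc n)
    then have "\<omega> n \<in> space M" using that by (auto simp: space_PiM PiE_iff)
    then show ?thesis
      using measurable_space[OF K'] Suc by (simp add: chain_step_def space_prob_algebra)
  qed
  from 1 2 show ?thesis by (rule Ionescu_Tulcea.intro)
qed

lemma space_chain_law:
  assumes "markov_kernel M K" and "x \<in> space M"
  shows "space (chain_law M K x) = space (PiM UNIV (\<lambda>_. M))"
proof -
  interpret Ionescu_Tulcea "chain_step M K x" "\<lambda>_. M"
    using assms by (rule Ionescu_Tulcea_chain_step)
  show ?thesis unfolding chain_law_def by (rule PF.space_lim)
qed

definition hitting_time :: "'a set \<Rightarrow> (nat \<Rightarrow> 'a) \<Rightarrow> ereal" where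
  "hitting_time A \<omega> = (INF t\<in>{t. \<omega> t \<in> A}. ereal (real t))"

section \<open>Logarithms and polynomial bounds\<close>

text \<open>
  The logarithm extended by \<open>log 0 = - \<infinity>\<close> and \<open>log \<infinity> = \<infinity>\<close>, since hitting times can be infinite.
\<close>

definition ereal_ln :: "ereal \<Rightarrow> ereal" where
  "ereal_ln y = (if y = \<infinity> then \<infinity> else if y \<le> 0 then - \<infinity> else ereal (ln (real_of_ereal y)))"

definition polynomially_bounded :: "(real \<Rightarrow> real) \<Rightarrow> bool" where
  "polynomially_bounded f \<longleftrightarrow> (\<forall>\<beta>\<ge>0. 0 \<le> f \<beta>) \<and>
     (\<exists>(g :: real poly) C1 C2. 0 < C1 \<and> 0 < C2 \<and> (\<forall>\<beta>>C1. f \<beta> \<le> C2 * poly g \<beta>))"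

end

theory Submission
  imports Defs "HOL-Real_Asymp.Real_Asymp"
begin

text \<open>
  Fix a large \<open>\<beta>\<close>. The Metropolis-Hastings chain dominates the original chain killed on leaving \<open>S\<close>,
  so the probability of staying in \<open>S\<close> for \<open>r1 + 1\<close> steps is at most the mean of \<open>Q(z, S)\<close> for \<open>z\<close>
  drawn from the Metropolis-Hastings chain after \<open>r1\<close> steps. By rapid mixing, from every point
  of \<open>G\<close> it is at most \<open>1 - p\<close> with \<open>p = (1 - \<beta>\<^sup>-\<^sup>2) \<Phi>\<close>. If the chain has not
  left \<open>S\<close> by then, it is in \<open>W\<close> and after \<open>r2\<close> further steps has visited \<open>G\<close> or left \<open>S\<close>, up to an
  event of probability \<open>e = O(\<beta>\<^sup>-\<^sup>2 \<Phi>)\<close>. Survival probabilities decrease with time, so the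
  excursion may be restarted in \<open>G\<close>, and \<open>j\<close> rounds give the survival bound
  \<open>(1 - p) ^ j + e / p\<close>. Since a round takes polynomially many steps while \<open>\<Phi>\<close> is exponentially
  small, time \<open>\<Phi> powr - (1 + \<epsilon>)\<close> has room for \<open>j\<close> rounds with \<open>p j\<close> tending to infinity, and
  \<open>e / p\<close> tends to \<open>0\<close>.
\<close>

section \<open>Killed operators and their measurability\<close>

text \<open>
  The \<open>n\<close>-th iterate of this operator, at a point of \<open>A\<close>, is the expectation of \<open>f (X n)\<close> on the event
  that the chain stays in \<open>A\<close> up to time \<open>n\<close>; in particular the semigroup law of the iterates
  takes the place of the Markov property.
\<close>

definition killed :: "('a \<Rightarrow> 'a measure) \<Rightarrow> 'a set \<Rightarrow> ('a \<Rightarrow> ennreal) \<Rightarrow> 'a \<Rightarrow> ennreal" where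
  "killed K A f y = (\<integral>\<^sup>+z\<in>A. f z \<partial>K y)"

lemma markov_kernel_subprob: "markov_kernel M K \<Longrightarrow> K \<in> M \<rightarrow>\<^sub>M subprob_algebra M"
  by (simp add: markov_kernel_def measurable_prob_algebraD)

lemma markov_kernelD:
  assumes "markov_kernel M K" and "y \<in> space M"
  shows "prob_space (K y)" and "sets (K y) = sets M" and "space (K y) = space M"
proof -
  have "K y \<in> space (prob_algebra M)"
    using assms by (auto simp: markov_kernel_def dest: measurable_space)
  then show "prob_space (K y)" "sets (K y) = sets M"
    by (simp_all add: space_prob_algebra)
  then show "space (K y) = space M"
    by (metis sets_eq_imp_space_eq)
qed

lemma measurable_killed:
  assumes "markov_kernel M K" and [measurable]: "A \<in> sets M" "f \<in> borel_measurable M"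
  shows "killed K A f \<in> borel_measurable M"
proof -
  note [measurable] = markov_kernel_subprob[OF assms(1)]
  show ?thesis
    unfolding killed_def[abs_def] by measurable
qed

lemma measurable_funpow_killed:
  assumes "markov_kernel M K" and "A \<in> sets M" and "f \<in> borel_measurable M"
  shows "(killed K A ^^ n) f \<in> borel_measurable M"
  using assms by (induction n) (auto intro: measurable_killed)

lemma sets_chain_law:
  assumes "markov_kernel M K" and "x \<in> space M"
  shows "sets (chain_law M K x) = sets (PiM UNIV (\<lambda>_. M))"
proof -
  interpret Ionescu_Tulcea "chain_step M K x" "\<lambda>_. M"
    using assms by (rule Ionescu_Tulcea_chain_step)
  show ?thesis unfolding chain_law_def by (rule PF.sets_lim)
qed

section \<open>The law on path space expressed through killed operators\<close>

context
  fixes M :: "'a measure" and K :: "'a \<Rightarrow> 'a measure" and x :: 'a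
  assumes K: "markov_kernel M K" and x: "x \<in> space M"
begin

interpretation Ionescu_Tulcea "chain_step M K x" "\<lambda>_. M"
  using K x by (rule Ionescu_Tulcea_chain_step)

text \<open>The path law is a projective limit whose marginal on the first \<open>n\<close>
  coordinates is the iterated product \<open>C 0 n\<close> started from the empty path
  \<open>\<lambda>_. undefined\<close>. A cylinder over the full index set is the set itself, which
  identifies \<open>CI {0..<n}\<close> with that product.\<close>

lemma nn_integral_chain_law_restrict:
  assumes f: "f \<in> borel_measurable (PiM {0..<n} (\<lambda>_. M))"
  shows "(\<integral>\<^sup>+\<omega>. f (restrict \<omega> {0..<n}) \<partial>chain_law M K x) = (\<integral>\<^sup>+\<omega>. f \<omega> \<partial>C 0 n (\<lambda>_. undefined))"
proof -
  have "CI {0..<n} = C 0 n (\<lambda>_. undefined)"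
  proof (rule measure_eqI)
    show "sets (CI {0..<n}) = sets (C 0 n (\<lambda>_. undefined))"
      by (simp add: CI_def sets_C)
    fix X assume "X \<in> sets (CI {0..<n})"
    then have X: "X \<in> sets (PiM {0..<n} (\<lambda>_. M))"
      by (simp add: CI_def)
    have "PF.emb {0..<n} {0..<n} X = X"
      using sets.sets_into_space[OF X] by (intro prod_emb_id) (simp add: space_PiM)
    with emeasure_CI[OF _ X, of n] show "emeasure (CI {0..<n}) X = emeasure (C 0 n (\<lambda>_. undefined)) X"
      by simp
  qed
  then have "C 0 n (\<lambda>_. undefined) = distr PF.lim (PiM {0..<n} (\<lambda>_. M)) (\<lambda>x. restrict x {0..<n})"
    by (simp add: distr_lim)
  with f show ?thesis
    by (simp add: chain_law_def nn_integral_distr measurable_cong_sets[OF PF.sets_lim])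
qed

lemma prob_space_chain_law: "prob_space (chain_law M K x)"
proof
  have "emeasure (chain_law M K x) (space (chain_law M K x)) = (\<integral>\<^sup>+\<omega>. 1 \<partial>chain_law M K x)"
    by simp
  also have "\<dots> = (\<integral>\<^sup>+\<omega>. 1 \<partial>C 0 0 (\<lambda>_. undefined))"
    by (subst nn_integral_chain_law_restrict[symmetric]) auto
  also have "\<dots> = 1"
    using prob_space_C[of "\<lambda>_. undefined" 0 0] by (simp add: prob_space.emeasure_space_1)
  finally show "emeasure (chain_law M K x) (space (chain_law M K x)) = 1" .
qed

text \<open>Fubini for the last coordinate: \<open>C 0 (Suc n)\<close> is \<open>C 0 n\<close>
  followed by one draw from \<open>chain_step\<close>.\<close>

lemma nn_integral_C_Suc:
  assumes [measurable]: "g \<in> borel_measurable (PiM {0..<Suc n} (\<lambda>_. M))"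
  shows "(\<integral>\<^sup>+\<omega>. g \<omega> \<partial>C 0 (Suc n) (\<lambda>_. undefined)) =
    (\<integral>\<^sup>+\<omega>. (\<integral>\<^sup>+z. g (fun_upd \<omega> n z) \<partial>chain_step M K x n \<omega>) \<partial>C 0 n (\<lambda>_. undefined))"
proof -
  have "(\<integral>\<^sup>+\<omega>. g \<omega> \<partial>C 0 (Suc n) (\<lambda>_. undefined)) =
      (\<integral>\<^sup>+\<omega>. (\<integral>\<^sup>+\<omega>. g \<omega> \<partial>eP n \<omega>) \<partial>C 0 n (\<lambda>_. undefined))"
    unfolding C.simps(2) add_0
    by (rule nn_integral_bind[where B="PiM {0..<Suc n} (\<lambda>_. M)"])
       (simp_all add: measurable_cong_sets[OF sets_C refl])
  also have "\<dots> = (\<integral>\<^sup>+\<omega>. (\<integral>\<^sup>+z. g (fun_upd \<omega> n z) \<partial>chain_step M K x n \<omega>) \<partial>C 0 n (\<lambda>_. undefined))"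
    by (intro nn_integral_cong nn_integral_eP) (simp_all add: space_C)
  finally show ?thesis .
qed

text \<open>Integrating out the last coordinate turns \<open>f\<close> into
  \<open>killed K A f\<close> and leaves the remaining indicators, so the induction needs arbitrary
  \<open>f\<close>. The factor in front is the indicator at time \<open>0\<close>, which the
  iterates of \<open>killed\<close> never test.\<close>

lemma nn_integral_C_killed:
  assumes A: "A \<in> sets M" and f: "f \<in> borel_measurable M"
  shows "(\<integral>\<^sup>+\<omega>. f (\<omega> n) * (\<Prod>i\<le>n. indicator A (\<omega> i)) \<partial>C 0 (Suc n) (\<lambda>_. undefined)) =
    indicator A x * (killed K A ^^ n) f x"
  using f
proof (induction n arbitrary: f)
  case 0
  note [measurable] = A 0
  show ?case
    apply (subst nn_integral_C_Suc)
     apply measurable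
    apply (simp add: chain_step_def nn_integral_return x mult.commute)
    done
next
  case (Suc n)
  note [measurable] = A Suc.prems markov_kernel_subprob[OF K]
  let ?u = "\<lambda>_. undefined"
  have m: "killed K A f \<in> borel_measurable M"
    using K A Suc.prems by (rule measurable_killed)
  have "(\<integral>\<^sup>+\<omega>. f (\<omega> (Suc n)) * (\<Prod>i\<le>Suc n. indicator A (\<omega> i)) \<partial>C 0 (Suc (Suc n)) ?u) =
    (\<integral>\<^sup>+\<omega>. (\<integral>\<^sup>+z. f z * (indicator A z * (\<Prod>i\<le>n. indicator A (\<omega> i))) \<partial>K (\<omega> n)) \<partial>C 0 (Suc n) ?u)"
    by (subst nn_integral_C_Suc) (measurable, simp add: chain_step_def mult.commute)
  also have "\<dots> = (\<integral>\<^sup>+\<omega>. killed K A f (\<omega> n) * (\<Prod>i\<le>n. indicator A (\<omega> i)) \<partial>C 0 (Suc n) ?u)"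
  proof (rule nn_integral_cong)
    fix \<omega> assume "\<omega> \<in> space (C 0 (Suc n) ?u)"
    then have \<omega>: "\<omega> \<in> space (PiM {0..<Suc n} (\<lambda>_. M))"
      by (simp add: space_C del: C.simps)
    then have \<omega>n: "\<omega> n \<in> space M"
      by (auto simp: space_PiM PiE_iff)
    show "(\<integral>\<^sup>+z. f z * (indicator A z * (\<Prod>i\<le>n. indicator A (\<omega> i))) \<partial>K (\<omega> n)) =
      killed K A f (\<omega> n) * (\<Prod>i\<le>n. indicator A (\<omega> i))"
      unfolding killed_def mult.assoc[symmetric] 
      by (rule nn_integral_multc)
        (simp add: measurable_cong_sets[OF markov_kernelD(2)[OF K \<omega>n] refl])
  qed
  also have "\<dots> = indicator A x * (killed K A ^^ Suc n) f x"
    using Suc.IH[OF m] by (simp add: funpow_swap1)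
  finally show ?case .
qed

text \<open>Carries path events over to iterates of \<open>killed\<close>: the event depends only on
  the first \<open>Suc n\<close> coordinates, so the marginal formula applies.\<close>

lemma emeasure_chain_law_killed:
  assumes A: "A \<in> sets M" and B: "B \<in> sets M"
  shows "emeasure (chain_law M K x) {\<omega> \<in> space (chain_law M K x). (\<forall>i\<le>n. \<omega> i \<in> A) \<and> \<omega> n \<in> B} =
    indicator A x * (killed K A ^^ n) (indicator B) x"
proof -
  note [measurable] = A B
  note [measurable_cong] = sets_chain_law[OF K x]
  have "emeasure (chain_law M K x) {\<omega> \<in> space (chain_law M K x). (\<forall>i\<le>n. \<omega> i \<in> A) \<and> \<omega> n \<in> B} =
    (\<integral>\<^sup>+\<omega>. indicator {\<omega> \<in> space (chain_law M K x). (\<forall>i\<le>n. \<omega> i \<in> A) \<and> \<omega> n \<in> B} \<omega> \<partial>chain_law M K x)"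
    by (rule nn_integral_indicator[symmetric]) measurable
  also have "\<dots> = (\<integral>\<^sup>+\<omega>. (\<lambda>\<omega>. indicator B (\<omega> n) * (\<Prod>i\<le>n. indicator A (\<omega> i))) (restrict \<omega> {0..<Suc n}) \<partial>chain_law M K x)"
  proof (rule nn_integral_cong)
    fix \<omega> assume "\<omega> \<in> space (chain_law M K x)"
    moreover have "(\<Prod>i\<le>n. indicator A (\<omega> i) :: ennreal) = (if \<forall>i\<le>n. \<omega> i \<in> A then 1 else 0)"
      by (auto intro!: prod.neutral simp: indicator_def)
    ultimately show "indicator {\<omega> \<in> space (chain_law M K x). (\<forall>i\<le>n. \<omega> i \<in> A) \<and> \<omega> n \<in> B} \<omega> =
        (indicator B (restrict \<omega> {0..<Suc n} n) * (\<Prod>i\<le>n. indicator A (restrict \<omega> {0..<Suc n} i)) :: ennreal)"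
      by (auto simp: indicator_def)
  qed
  also have "\<dots> = indicator A x * (killed K A ^^ n) (indicator B) x"
    by (subst nn_integral_chain_law_restrict) (measurable, simp add: nn_integral_C_killed del: C.simps)
  finally show ?thesis .
qed

end

section \<open>Monotonicity, linearity and survival probabilities\<close>

lemma killed_mono:
  assumes "\<And>z. z \<in> A \<Longrightarrow> f z \<le> g z"
  shows "killed K A f y \<le> killed K A g y"
  unfolding killed_def using assms by (intro nn_integral_mono) (auto split: split_indicator)

lemma funpow_killed_mono:
  assumes "\<And>z. z \<in> A \<Longrightarrow> f z \<le> g z" and "y \<in> A"
  shows "(killed K A ^^ n) f y \<le> (killed K A ^^ n) g y"
  using assms by (induction n arbitrary: y) (auto intro: killed_mono)

lemma killed_affine:
  assumes K: "markov_kernel M K" and A: "A \<in> sets M" and f: "f \<in> borel_measurable M" 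
    and g: "g \<in> borel_measurable M" and y: "y \<in> space M"
  shows "killed K A (\<lambda>z. c * f z + g z) y = c * killed K A f y + killed K A g y"
proof -
  note [simp] = measurable_cong_sets[OF markov_kernelD(2)[OF K y] refl]
  show ?thesis
    unfolding killed_def using A f g
    by (simp add: distrib_right mult.assoc nn_integral_add nn_integral_cmult)
qed

text \<open>A constant comes out multiplied by the survival probability. This factor is what later
  makes each round contract.\<close>

lemma funpow_killed_affine:
  assumes K: "markov_kernel M K" and A: "A \<in> sets M" and f: "f \<in> borel_measurable M"
    and y: "y \<in> space M"
  shows "(killed K A ^^ n) (\<lambda>z. c + f z) y = c * (killed K A ^^ n) (\<lambda>_. 1) y + (killed K A ^^ n) f y"
  using y
proof (induction n arbitrary: y)
  case (Suc n)
  have "killed K A ((killed K A ^^ n) (\<lambda>z. c + f z)) y =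
    killed K A (\<lambda>z. c * (killed K A ^^ n) (\<lambda>_. 1) z + (killed K A ^^ n) f z) y"
    unfolding killed_def
    by (intro nn_integral_cong arg_cong2[where f="(*)"] Suc.IH[unfolded killed_def] refl)
      (simp add: markov_kernelD(3)[OF K Suc.prems])
  with Suc.prems show ?case
    by (simp add: killed_affine[OF K A] measurable_funpow_killed[OF K A] f)
qed simp

lemma killed_le_1:
  assumes K: "markov_kernel M K" and y: "y \<in> space M" and "\<And>z. z \<in> A \<Longrightarrow> f z \<le> 1"
  shows "killed K A f y \<le> 1"
proof -
  interpret prob_space "K y" by (rule markov_kernelD[OF K y])
  have "killed K A f y \<le> (\<integral>\<^sup>+z. 1 \<partial>K y)"
    unfolding killed_def using assms(3) by (intro nn_integral_mono) (auto split: split_indicator)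
  then show ?thesis by (simp add: emeasure_space_1)
qed

lemma funpow_killed_1_le_1:
  assumes K: "markov_kernel M K" and A: "A \<subseteq> space M" and y: "y \<in> space M"
  shows "(killed K A ^^ n) (\<lambda>_. 1) y \<le> 1"
  using y by (induction n arbitrary: y) (use A in \<open>auto intro!: killed_le_1[OF K]\<close>)

text \<open>The last \<open>m\<close> steps map the constant \<open>1\<close> to something at most
  \<open>1\<close>, and the first \<open>n\<close> steps are monotone.\<close>

lemma funpow_killed_1_decreasing:
  assumes K: "markov_kernel M K" and A: "A \<subseteq> space M" and y: "y \<in> A"
  shows "(killed K A ^^ (n + m)) (\<lambda>_. 1) y \<le> (killed K A ^^ n) (\<lambda>_. 1) y"
  unfolding funpow_add comp_def using assms
  by (intro funpow_killed_mono funpow_killed_1_le_1[OF K]) auto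

text \<open>Either the chain avoids \<open>G\<close> up to time \<open>m\<close>, or it visits
  \<open>G\<close> with at least \<open>n\<close> steps still to survive, which has probability at
  most \<open>s\<close>. Induction on the first step replaces the strong Markov property.\<close>

lemma funpow_killed_return_bound:
  assumes K: "markov_kernel M K" and S: "S \<in> sets M" and G: "G \<in> sets M" "G \<subseteq> S"
    and s: "\<And>y. y \<in> G \<Longrightarrow> (killed K S ^^ n) (\<lambda>_. 1) y \<le> s"
    and y: "y \<in> S"
  shows "(killed K S ^^ (n + m)) (\<lambda>_. 1) y \<le>
    s + indicator (S - G) y * (killed K (S - G) ^^ m) (\<lambda>_. 1) y"
  using y
proof (induction m arbitrary: y)
  have sub: "S \<subseteq> space M" using sets.sets_into_space[OF S] .
  have G_case: "(killed K S ^^ (n + m)) (\<lambda>_. 1) y \<le> s" if "y \<in> G" for y m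
    using funpow_killed_1_decreasing[OF K sub, of y n m] s[OF that] that G by (auto intro: order_trans)
  {
    case 0
    then show ?case
      using G_case[of y 0] sub
      by (auto split: split_indicator intro!: add_increasing funpow_killed_1_le_1[OF K])
  next
    case (Suc m)
    let ?v = "(killed K (S - G) ^^ m) (\<lambda>_. 1)"
    show ?case
    proof (cases "y \<in> G")
      case True
      then show ?thesis using G_case[of y "Suc m"] by simp
    next
      case False
      have ySp: "y \<in> space M" using Suc.prems sub by auto
      have SG: "S - G \<in> sets M" using S G by auto
      have mv: "?v \<in> borel_measurable M" 
        using SG by (intro measurable_funpow_killed[OF K]) auto
      have "(killed K S ^^ (n + Suc m)) (\<lambda>_. 1) y = killed K S ((killed K S ^^ (n + m)) (\<lambda>_. 1)) y"
        by simp
      also have "\<dots> \<le> killed K S (\<lambda>z. s * 1 + indicator (S - G) z * ?v z) y"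
        using Suc.IH by (intro killed_mono) simp
      also have "\<dots> = s * killed K S (\<lambda>_. 1) y + killed K S (\<lambda>z. indicator (S - G) z * ?v z) y"
        using mv SG by (intro killed_affine[OF K S _ _ ySp]) auto
      \<comment> \<open>One step has mass at most \<open>1\<close>, so the summand \<open>s\<close>
        does not grow along the induction.\<close>
      also have "\<dots> \<le> s * 1 + killed K (S - G) ?v y"
      proof (intro add_mono mult_left_mono killed_le_1[OF K ySp])
        show "killed K S (\<lambda>z. indicator (S - G) z * ?v z) y \<le> killed K (S - G) ?v y"
          unfolding killed_def by (intro nn_integral_mono) (auto split: split_indicator)
      qed auto
      finally show ?thesis using False Suc.prems by simp
    qed
  }
qed

section \<open>Comparison with the Metropolis-Hastings chain\<close>

lemma markov_kernel_mh_kernel: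
  assumes K: "markov_kernel M K" and S: "S \<in> sets M"
  shows "markov_kernel M (mh_kernel M K S)"
proof -
  note [measurable] = markov_kernel_subprob[OF K] S
  have "mh_kernel M K S \<in> M \<rightarrow>\<^sub>M subprob_algebra M"
    unfolding mh_kernel_def[abs_def] by (rule measurable_distr2) measurable
  moreover have "prob_space (mh_kernel M K S y)" if y: "y \<in> space M" for y
  proof -
    note [measurable_cong] = markov_kernelD(2)[OF K y]
    show ?thesis unfolding mh_kernel_def
      using y by (intro prob_space.prob_space_distr markov_kernelD(1)[OF K]) measurable
  qed
  ultimately show ?thesis
    unfolding markov_kernel_def prob_algebra_def
    by (intro measurable_restrict_space2) auto
qed

lemma kernel_power_prob_algebra:
  assumes K: "markov_kernel M K" and y: "y \<in> space M"
  shows "kernel_power M K n y \<in> space (prob_algebra M)"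
proof (induction n)
  case 0
  with y show ?case by (simp add: space_prob_algebra prob_space_return)
next
  case (Suc n)
  then show ?case
    using K by (simp add: space_prob_algebra[of M] markov_kernel_def prob_space_bind'[OF Suc] sets_bind'[OF Suc])
qed

text \<open>Proposals in \<open>S\<close> are accepted unchanged, so the Metropolis-Hastings
  integral is that of \<open>killed\<close> plus the nonnegative contribution of rejected
  proposals.\<close>

lemma killed_le_mh_kernel:
  assumes K: "markov_kernel M K" and S: "S \<in> sets M" and y: "y \<in> space M"
    and f: "f \<in> borel_measurable M"
  shows "killed K S f y \<le> (\<integral>\<^sup>+z. f z \<partial>mh_kernel M K S y)"
proof -
  note [measurable] = S
  note [measurable_cong] = markov_kernelD(2)[OF K y]
  have "(\<integral>\<^sup>+z. f z \<partial>mh_kernel M K S y) = (\<integral>\<^sup>+z. f (if z \<in> S then z else y) \<partial>K y)"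
    unfolding mh_kernel_def using f y by (intro nn_integral_distr) measurable
  then show ?thesis
    unfolding killed_def by (auto intro!: nn_integral_mono split: split_indicator)
qed

text \<open>\<open>kernel_power\<close> appends its new step at the end of the path, so the
  innermost \<open>killed\<close> is compared first and \<open>f\<close> varies in the
  induction.\<close>

lemma funpow_killed_le_kernel_power:
  assumes K: "markov_kernel M K" and S: "S \<in> sets M" and y: "y \<in> space M"
    and f: "f \<in> borel_measurable M"
  shows "(killed K S ^^ n) f y \<le> (\<integral>\<^sup>+z. f z \<partial>kernel_power M (mh_kernel M K S) n y)"
  using f
proof (induction n arbitrary: f)
  case 0
  with y show ?case by (simp add: nn_integral_return)
next
  case (Suc n)
  let ?H = "mh_kernel M K S"
  note H = markov_kernel_mh_kernel[OF K S]
  have *: "kernel_power M ?H n y \<in> space (prob_algebra M)"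
    by (rule kernel_power_prob_algebra[OF H y])
  then have sets: "sets (kernel_power M ?H n y) = sets M"
    by (simp add: space_prob_algebra)
  have "(killed K S ^^ Suc n) f y = (killed K S ^^ n) (killed K S f) y"
    by (simp add: funpow_swap1)
  also have "\<dots> \<le> (\<integral>\<^sup>+z. killed K S f z \<partial>kernel_power M ?H n y)"
    using Suc.prems by (intro Suc.IH measurable_killed[OF K S])
  also have "\<dots> \<le> (\<integral>\<^sup>+z. (\<integral>\<^sup>+w. f w \<partial>?H z) \<partial>kernel_power M ?H n y)"
    using Suc.prems by (intro nn_integral_mono killed_le_mh_kernel[OF K S]) (simp_all add: sets_eq_imp_space_eq[OF sets])
  also have "\<dots> = (\<integral>\<^sup>+z. f z \<partial>kernel_power M ?H (Suc n) y)"
    unfolding kernel_power.simps using Suc.prems markov_kernel_subprob[OF H]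
    by (intro nn_integral_bind[symmetric]) (simp_all add: measurable_cong_sets[OF sets refl])
  finally show ?case .
qed

section \<open>Total variation distance and integrals\<close>

text \<open>Write \<open>f z\<close> as the length of \<open>{0..<f z}\<close> and exchange the
  integrals. This reduces integrals to measures of sets, which are all that \<open>tv_dist\<close>
  compares.\<close>

lemma nn_integral_layer_cake:
  assumes "finite_measure \<mu>" and [measurable]: "f \<in> borel_measurable \<mu>"
    and f: "\<And>z. z \<in> space \<mu> \<Longrightarrow> f z \<in> {0..1::real}"
  shows "(\<integral>\<^sup>+z. ennreal (f z) \<partial>\<mu>) = (\<integral>\<^sup>+t\<in>{0..1}. emeasure \<mu> {z \<in> space \<mu>. t < f z} \<partial>lborel)"
proof -
  interpret finite_measure \<mu> by fact
  interpret pair_sigma_finite \<mu> "lborel :: real measure" ..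
  have "(\<integral>\<^sup>+z. ennreal (f z) \<partial>\<mu>) = (\<integral>\<^sup>+z. (\<integral>\<^sup>+t. indicator {0..1} t * indicator {..<f z} t \<partial>lborel) \<partial>\<mu>)"
  proof (rule nn_integral_cong)
    fix z assume "z \<in> space \<mu>"
    with f[of z] have "{0..1} \<inter> {..<f z} = {0..<f z}" by auto
    then have "(\<integral>\<^sup>+t. indicator {0..1} t * indicator {..<f z} t \<partial>lborel) = emeasure lborel {0..<f z}"
      by (simp add: indicator_inter_arith[symmetric])
    then show "ennreal (f z) = (\<integral>\<^sup>+t. indicator {0..1} t * indicator {..<f z} t \<partial>lborel)"
      using f[OF \<open>z \<in> space \<mu>\<close>] by simp
  qed
  also have "\<dots> = (\<integral>\<^sup>+z. (\<integral>\<^sup>+t. indicator {0..1} t * indicator {p \<in> space (\<mu> \<Otimes>\<^sub>M lborel). snd p < f (fst p)} (z, t) \<partial>lborel) \<partial>\<mu>)"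
    by (intro nn_integral_cong) (auto simp: space_pair_measure split: split_indicator)
  also have "\<dots> = (\<integral>\<^sup>+t. (\<integral>\<^sup>+z. indicator {0..1} t * indicator {p \<in> space (\<mu> \<Otimes>\<^sub>M lborel). snd p < f (fst p)} (z, t) \<partial>\<mu>) \<partial>lborel)"
    by (rule Fubini'[symmetric]) measurable
  also have "\<dots> = (\<integral>\<^sup>+t\<in>{0..1}. emeasure \<mu> {z \<in> space \<mu>. t < f z} \<partial>lborel)"
  proof (rule nn_integral_cong)
    fix t :: real
    have "(\<integral>\<^sup>+z. indicator {0..1} t * indicator {p \<in> space (\<mu> \<Otimes>\<^sub>M lborel). snd p < f (fst p)} (z, t) \<partial>\<mu>) =
      (\<integral>\<^sup>+z. indicator {0..1} t * indicator {z \<in> space \<mu>. t < f z} z \<partial>\<mu>)"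
      by (intro nn_integral_cong) (auto simp: space_pair_measure split: split_indicator)
    also have "\<dots> = emeasure \<mu> {z \<in> space \<mu>. t < f z} * indicator {0..1} t"
      by (simp add: nn_integral_cmult mult.commute)
    finally show "(\<integral>\<^sup>+z. indicator {0..1} t * indicator {p \<in> space (\<mu> \<Otimes>\<^sub>M lborel). snd p < f (fst p)} (z, t) \<partial>\<mu>) =
      emeasure \<mu> {z \<in> space \<mu>. t < f z} * indicator {0..1} t" .
  qed
  finally show ?thesis .
qed

lemma measure_diff_le_tv_dist:
  assumes "prob_space \<mu>" and "prob_space \<nu>" and "A \<in> sets \<mu>"
  shows "\<bar>measure \<mu> A - measure \<nu> A\<bar> \<le> tv_dist \<mu> \<nu>"
  unfolding tv_dist_def
proof (rule cSUP_upper[OF assms(3)], rule bdd_aboveI2[where M=1])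
  fix B
  show "\<bar>measure \<mu> B - measure \<nu> B\<bar> \<le> 1"
    using prob_space.prob_le_1[OF assms(1), of B] prob_space.prob_le_1[OF assms(2), of B]
      measure_nonneg[of \<mu> B] measure_nonneg[of \<nu> B] by linarith
qed

text \<open>Each superlevel set costs at most \<open>tv_dist \<mu> \<nu>\<close>, and the levels
  fill an interval of length one, so the total cost carries no extra factor.\<close>

lemma nn_integral_le_tv_dist:
  assumes \<mu>: "prob_space \<mu>" and \<nu>: "prob_space \<nu>" and sets: "sets \<mu> = sets \<nu>"
    and f: "f \<in> borel_measurable \<mu>" "\<And>z. z \<in> space \<mu> \<Longrightarrow> f z \<in> {0..1::real}"
  shows "(\<integral>\<^sup>+z. ennreal (f z) \<partial>\<mu>) \<le> (\<integral>\<^sup>+z. ennreal (f z) \<partial>\<nu>) + ennreal (tv_dist \<mu> \<nu>)"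
proof -
  interpret \<mu>: prob_space \<mu> by fact
  interpret \<nu>: prob_space \<nu> by fact
  interpret pair_sigma_finite \<nu> "lborel :: real measure" ..
  note sp = sets_eq_imp_space_eq[OF sets]
  have f\<nu>[measurable]: "f \<in> borel_measurable \<nu>" 
    using f(1) by (simp add: measurable_cong_sets[OF sets refl])
  note [measurable] = f(1)
  let ?L = "\<lambda>\<mu> t. emeasure \<mu> {z \<in> space \<mu>. t < f z}"
  \<comment> \<open>Measurability in \<open>t\<close> of the mass of superlevel sets, needed to
    split the integral of a sum below, comes from sections of a measurable set in the
    product.\<close>
  have "{p \<in> space (lborel \<Otimes>\<^sub>M \<nu>). fst p < f (snd p)} \<in> sets (lborel \<Otimes>\<^sub>M \<nu>)"
    by measurable
  then have "(\<lambda>t. emeasure \<nu> (Pair t -` {p \<in> space (lborel \<Otimes>\<^sub>M \<nu>). fst p < f (snd p)})) \<in> borel_measurable lborel"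
    by (rule \<nu>.measurable_emeasure_Pair)
  then have L[measurable]: "?L \<nu> \<in> borel_measurable borel"
    by (simp add: space_pair_measure vimage_def)
  have "(\<integral>\<^sup>+z. ennreal (f z) \<partial>\<mu>) = (\<integral>\<^sup>+t\<in>{0..1}. ?L \<mu> t \<partial>lborel)"
    using f \<mu>.finite_measure_axioms by (intro nn_integral_layer_cake) auto
  also have "\<dots> \<le> (\<integral>\<^sup>+t. ?L \<nu> t * indicator {0..1} t + ennreal (tv_dist \<mu> \<nu>) * indicator {0..1} t \<partial>lborel)"
  proof (intro nn_integral_mono)
    fix t
    have "{z \<in> space \<mu>. t < f z} \<in> sets \<mu>" by measurable
    from measure_diff_le_tv_dist[OF \<mu> \<nu> this]
    have "measure \<mu> {z \<in> space \<mu>. t < f z} \<le> measure \<nu> {z \<in> space \<nu>. t < f z} + tv_dist \<mu> \<nu>"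
      by (simp add: sp)
    moreover have "0 \<le> tv_dist \<mu> \<nu>"
      using measure_diff_le_tv_dist[OF \<mu> \<nu>, of "{}"] by simp
    ultimately have "?L \<mu> t \<le> ?L \<nu> t + ennreal (tv_dist \<mu> \<nu>)"
      by (simp add: \<mu>.emeasure_eq_measure \<nu>.emeasure_eq_measure flip: ennreal_plus)
    then show "?L \<mu> t * indicator {0..1} t \<le> ?L \<nu> t * indicator {0..1} t + ennreal (tv_dist \<mu> \<nu>) * indicator {0..1} t"
      by (auto split: split_indicator)
  qed
  also have "\<dots> = (\<integral>\<^sup>+t\<in>{0..1}. ?L \<nu> t \<partial>lborel) + ennreal (tv_dist \<mu> \<nu>)"
    by (subst nn_integral_add) (auto simp: nn_integral_cmult)
  also have "(\<integral>\<^sup>+t\<in>{0..1}. ?L \<nu> t \<partial>lborel) = (\<integral>\<^sup>+z. ennreal (f z) \<partial>\<nu>)"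
    using f(2) \<nu>.finite_measure_axioms by (intro nn_integral_layer_cake[symmetric]) (auto simp: sp)
  finally show ?thesis .
qed

section \<open>Hitting times and their relation to killed operators\<close>

lemma hitting_time_le: "\<omega> t \<in> A \<Longrightarrow> hitting_time A \<omega> \<le> ereal (real t)"
  unfolding hitting_time_def by (rule INF_lower) simp

lemma hitting_time_ge_Suc:
  assumes "\<And>t. t \<le> n \<Longrightarrow> \<omega> t \<notin> A"
  shows "ereal (real (Suc n)) \<le> hitting_time A \<omega>"
  unfolding hitting_time_def using assms by (intro INF_greatest) (metis ereal_less_eq(3) mem_Collect_eq not_less_eq_eq of_nat_le_iff)

text \<open>The index set of the infimum depends on the path. Giving the value
  \<open>\<infinity>\<close> to all other times yields a countable infimum of measurable
  functions.\<close>

lemma measurable_hitting_time: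
  assumes [measurable]: "A \<in> sets M"
  shows "hitting_time A \<in> borel_measurable (PiM UNIV (\<lambda>_. M))"
proof -
  have "hitting_time A \<omega> = (INF t. if \<omega> t \<in> A then ereal (real t) else \<infinity>)" for \<omega>
  proof (rule antisym)
    show "hitting_time A \<omega> \<le> (INF t. if \<omega> t \<in> A then ereal (real t) else \<infinity>)"
      by (rule INF_greatest) (simp add: hitting_time_le)
    show "(INF t. if \<omega> t \<in> A then ereal (real t) else \<infinity>) \<le> hitting_time A \<omega>"
      unfolding hitting_time_def
      by (rule INF_mono) (metis UNIV_I mem_Collect_eq order_refl)
  qed
  then have "hitting_time A = (\<lambda>\<omega>. INF t. if \<omega> t \<in> A then ereal (real t) else \<infinity>)"
    by auto
  moreover have "(\<lambda>\<omega>. INF t. if \<omega> t \<in> A then ereal (real t) else \<infinity>) \<in> borel_measurable (PiM UNIV (\<lambda>_. M))"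
    by measurable
  ultimately show ?thesis by (simp only:)
qed

text \<open>\<open>indicator A\<close> and the constant \<open>1\<close> agree on \<open>A\<close>,
  hence so do their iterates at points of \<open>A\<close>.\<close>

lemma emeasure_chain_law_stay:
  assumes K: "markov_kernel M K" and x: "x \<in> A" and A: "A \<in> sets M"
  shows "emeasure (chain_law M K x) {\<omega> \<in> space (chain_law M K x). \<forall>i\<le>n. \<omega> i \<in> A} =
    (killed K A ^^ n) (\<lambda>_. 1) x"
proof -
  have sub: "A \<subseteq> space M" using sets.sets_into_space[OF A] .
  have "{\<omega> \<in> space (chain_law M K x). \<forall>i\<le>n. \<omega> i \<in> A} =
      {\<omega> \<in> space (chain_law M K x). (\<forall>i\<le>n. \<omega> i \<in> A) \<and> \<omega> n \<in> A}"
    by auto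
  moreover have "(killed K A ^^ n) (indicator A) x = (killed K A ^^ n) (\<lambda>_. 1) x"
    using x by (intro antisym funpow_killed_mono) auto
  ultimately show ?thesis
    using emeasure_chain_law_killed[OF K _ A A, of x n] x sub by auto
qed

text \<open>Staying in \<open>S - G\<close> up to time \<open>nat \<lfloor>r\<rfloor>\<close> puts
  the hitting time at \<open>nat \<lfloor>r\<rfloor> + 1\<close> or later, which exceeds the real
  number \<open>r\<close>.\<close>

lemma killed_le_never_stuck:
  assumes K: "markov_kernel M K" and S: "S \<in> sets M" and G: "G \<in> sets M" "G \<subseteq> S"
    and y: "y \<in> S - G" and r: "0 \<le> r"
    and P: "\<P>(\<omega> in chain_law M K y. hitting_time (G \<union> (space M - S)) \<omega> > ereal r) \<le> \<delta>"
  shows "(killed K (S - G) ^^ nat \<lfloor>r\<rfloor>) (\<lambda>_. 1) y \<le> ennreal \<delta>"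
proof -
  let ?P = "chain_law M K y" and ?m = "nat \<lfloor>r\<rfloor>"
  have ysp: "y \<in> space M" using y sets.sets_into_space[OF S] by auto
  interpret prob_space ?P by (rule prob_space_chain_law[OF K ysp])
  note [measurable_cong] = sets_chain_law[OF K ysp]
  have T: "G \<union> (space M - S) \<in> sets M" using G S by auto
  note [measurable] = measurable_hitting_time[OF T]
  have "r < real (Suc ?m)" using r by linarith
  have "(killed K (S - G) ^^ ?m) (\<lambda>_. 1) y = emeasure ?P {\<omega> \<in> space ?P. \<forall>i\<le>?m. \<omega> i \<in> S - G}"
    using G S y by (intro emeasure_chain_law_stay[OF K, symmetric]) auto
  also have "\<dots> \<le> emeasure ?P {\<omega> \<in> space ?P. hitting_time (G \<union> (space M - S)) \<omega> > ereal r}"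
  proof (intro emeasure_mono subsetI CollectI conjI)
    fix \<omega> assume \<omega>: "\<omega> \<in> {\<omega> \<in> space ?P. \<forall>i\<le>?m. \<omega> i \<in> S - G}"
    then have "ereal (real (Suc ?m)) \<le> hitting_time (G \<union> (space M - S)) \<omega>"
      by (intro hitting_time_ge_Suc) auto
    with \<open>r < real (Suc ?m)\<close> show "ereal r < hitting_time (G \<union> (space M - S)) \<omega>"
      by (metis less_ereal.simps(1) less_le_trans)
  qed (auto, measurable)
  also have "\<dots> \<le> ennreal \<delta>"
    using P by (simp add: emeasure_eq_measure ennreal_leI)
  finally show ?thesis .
qed

text \<open>A path that stays in \<open>S\<close> up to time \<open>n\<close> and is outside
  \<open>W\<close> at that time has hit the complement of \<open>W\<close> by time \<open>n\<close>,
  before \<open>r\<close>, and leaves \<open>S\<close> no earlier than \<open>n + 1\<close>.\<close>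

lemma killed_le_never_hit:
  assumes K: "markov_kernel M K" and S: "S \<in> sets M" and W: "W \<in> sets M"
    and y: "y \<in> S" and n: "real n < r"
    and P: "\<P>(\<omega> in chain_law M K y. hitting_time (space M - W) \<omega>
      < min (ereal r) (hitting_time (space M - S) \<omega>)) \<le> b"
  shows "(killed K S ^^ n) (indicator (S - W)) y \<le> ennreal b"
proof -
  let ?P = "chain_law M K y"
  have ysp: "y \<in> space M" using y sets.sets_into_space[OF S] by auto
  interpret prob_space ?P by (rule prob_space_chain_law[OF K ysp])
  note [measurable_cong] = sets_chain_law[OF K ysp]
  have T: "space M - W \<in> sets M" "space M - S \<in> sets M" using W S by auto
  note [measurable] = measurable_hitting_time[OF T(1)] measurable_hitting_time[OF T(2)]
  have "(killed K S ^^ n) (indicator (S - W)) y =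
      emeasure ?P {\<omega> \<in> space ?P. (\<forall>i\<le>n. \<omega> i \<in> S) \<and> \<omega> n \<in> S - W}"
    using S W y by (subst emeasure_chain_law_killed[OF K ysp]) auto
  also have "\<dots> \<le> emeasure ?P {\<omega> \<in> space ?P. hitting_time (space M - W) \<omega>
      < min (ereal r) (hitting_time (space M - S) \<omega>)}"
  proof (intro emeasure_mono subsetI CollectI conjI)
    fix \<omega> assume \<omega>: "\<omega> \<in> {\<omega> \<in> space ?P. (\<forall>i\<le>n. \<omega> i \<in> S) \<and> \<omega> n \<in> S - W}"
    have "hitting_time (space M - W) \<omega> \<le> ereal (real n)"
      using \<omega> sets.sets_into_space[OF S] by (intro hitting_time_le) auto
    moreover have "ereal (real (Suc n)) \<le> hitting_time (space M - S) \<omega>"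
      using \<omega> by (intro hitting_time_ge_Suc) auto
    moreover have "ereal (real n) < ereal (real (Suc n))" "ereal (real n) < ereal r"
      using n by auto
    ultimately show "hitting_time (space M - W) \<omega> < min (ereal r) (hitting_time (space M - S) \<omega>)"
      by (meson le_less_trans less_le_trans min_less_iff_conj)
  qed (auto, measurable)
  also have "\<dots> \<le> ennreal b"
    using P by (simp add: emeasure_eq_measure ennreal_leI)
  finally show ?thesis .
qed

section \<open>Conductance as an escape probability\<close>

text \<open>Exit probabilities are at most \<open>1\<close>, so their real integral in
  \<open>conductance\<close> exists and agrees with the nonnegative integral used for
  \<open>killed\<close>.\<close>

lemma
  assumes K: "markov_kernel M K" and S: "S \<in> sets M" and \<mu>: "\<mu> \<in> space (prob_algebra M)"
    and pos: "0 < measure \<mu> S"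
  shows nn_integral_exit_uniform_measure:
      "(\<integral>\<^sup>+z. ennreal (measure (K z) (space M - S)) \<partial>uniform_measure \<mu> S) = ennreal (conductance K \<mu> S)"
    and conductance_nonneg: "0 \<le> conductance K \<mu> S"
proof -
  note [measurable] = markov_kernel_subprob[OF K] S
  have sets[measurable_cong]: "sets \<mu> = sets M" and "prob_space \<mu>"
    using \<mu> by (auto simp: space_prob_algebra)
  interpret prob_space \<mu> by fact
  note sp = sets_eq_imp_space_eq[OF sets]
  let ?h = "\<lambda>z. measure (K z) (space M - S)"
  have h[measurable]: "?h \<in> borel_measurable \<mu>" by measurable
  have h1: "?h z \<le> 1" if "z \<in> space M" for z
    using markov_kernelD(1)[OF K that] by (rule prob_space.prob_le_1)
  have "integrable \<mu> (\<lambda>z. indicator S z * ?h z)"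
    by (rule integrable_const_bound[where B=1]) (use h1 in \<open>auto simp: sp split: split_indicator\<close>)
  then have "(\<integral>\<^sup>+z. ennreal (indicator S z * ?h z) \<partial>\<mu>) = ennreal (\<integral>z. indicator S z * ?h z \<partial>\<mu>)"
    by (intro nn_integral_eq_integral) auto
  moreover have "(\<integral>\<^sup>+z. ennreal (?h z) \<partial>uniform_measure \<mu> S) =
      (\<integral>\<^sup>+z. ennreal (indicator S z * ?h z) \<partial>\<mu>) / emeasure \<mu> S"
    by (subst nn_integral_uniform_measure)
      (auto simp: sets intro!: arg_cong2[where f="(/)"] nn_integral_cong split: split_indicator)
  ultimately show "(\<integral>\<^sup>+z. ennreal (?h z) \<partial>uniform_measure \<mu> S) = ennreal (conductance K \<mu> S)"
    using pos
    by (simp add: conductance_def set_lebesgue_integral_def emeasure_eq_measure sp divide_ennreal integral_nonneg_AE)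
  show "0 \<le> conductance K \<mu> S"
    by (simp add: conductance_def set_lebesgue_integral_def integral_nonneg_AE)
qed

text \<open>Under the restricted measure the mean of \<open>K z S\<close> is exactly one minus the
  conductance. After \<open>r\<close> Metropolis-Hastings steps this mean is off by at most
  \<open>t\<close>; the extra step in \<open>Suc r\<close> is the one that may leave
  \<open>S\<close>.\<close>

lemma funpow_killed_le_conductance:
  assumes K: "markov_kernel M K" and S: "S \<in> sets M" and \<mu>: "\<mu> \<in> space (prob_algebra M)"
    and pos: "0 < measure \<mu> S" and y: "y \<in> space M"
    and tv: "tv_dist (kernel_power M (mh_kernel M K S) r y) (uniform_measure \<mu> S) \<le> t"
    and le: "conductance K \<mu> S \<le> 1"
  shows "(killed K S ^^ Suc r) (\<lambda>_. 1) y \<le> ennreal (1 - (conductance K \<mu> S - t))"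
proof -
  note [measurable] = markov_kernel_subprob[OF K] S
  have sets: "sets \<mu> = sets M" and "prob_space \<mu>"
    using \<mu> by (auto simp: space_prob_algebra)
  interpret \<mu>: prob_space \<mu> by fact
  note sp = sets_eq_imp_space_eq[OF sets]
  let ?\<nu> = "uniform_measure \<mu> S" and ?\<kappa> = "kernel_power M (mh_kernel M K S) r y"
  have \<nu>: "prob_space ?\<nu>"
    using pos by (intro prob_space_uniform_measure) (simp_all add: \<mu>.emeasure_eq_measure)
  interpret \<nu>: prob_space ?\<nu> by fact
  have \<kappa>: "prob_space ?\<kappa>" "sets ?\<kappa> = sets M"
    using kernel_power_prob_algebra[OF markov_kernel_mh_kernel[OF K S] y, of r]
    by (simp_all add: space_prob_algebra)
  have sets_\<nu>: "sets ?\<nu> = sets M" by (simp add: sets)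
  let ?h = "\<lambda>z. measure (K z) (space M - S)" and ?g = "\<lambda>z. measure (K z) S"
  have g: "?g \<in> borel_measurable M" and h: "?h \<in> borel_measurable M" by measurable
  have g1: "?g z \<in> {0..1}" if "z \<in> space M" for z
    using prob_space.prob_le_1[OF markov_kernelD(1)[OF K that]] by simp
  have killed1: "killed K S (\<lambda>_. 1) z = ennreal (?g z)" if z: "z \<in> space M" for z
  proof -
    interpret Kz: prob_space "K z" by (rule markov_kernelD(1)[OF K z])
    show ?thesis
      unfolding killed_def using S by (simp add: markov_kernelD(2)[OF K z] Kz.emeasure_eq_measure)
  qed
  have gh: "ennreal (?g z) + ennreal (?h z) = 1" if z: "z \<in> space M" for z
  proof -
    interpret Kz: prob_space "K z" by (rule markov_kernelD(1)[OF K z])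
    have "?h z = 1 - ?g z"
      using Kz.prob_compl[of S] S by (simp add: markov_kernelD(2,3)[OF K z])
    then show ?thesis by (simp flip: ennreal_plus)
  qed
  have "(\<integral>\<^sup>+z. ennreal (?g z) \<partial>?\<nu>) + (\<integral>\<^sup>+z. ennreal (?h z) \<partial>?\<nu>) = (\<integral>\<^sup>+z. ennreal (?g z) + ennreal (?h z) \<partial>?\<nu>)"
    using g h by (intro nn_integral_add[symmetric]) (simp_all add: measurable_cong_sets[OF sets_\<nu> refl])
  also have "\<dots> = (\<integral>\<^sup>+z. 1 \<partial>?\<nu>)"
    by (intro nn_integral_cong gh) (simp add: sp)
  finally have "(\<integral>\<^sup>+z. ennreal (?g z) \<partial>?\<nu>) + ennreal (conductance K \<mu> S) = 1"
    by (simp add: nn_integral_exit_uniform_measure[OF K S \<mu> pos] \<nu>.emeasure_space_1 del: space_uniform_measure)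
  then have G: "(\<integral>\<^sup>+z. ennreal (?g z) \<partial>?\<nu>) = ennreal (1 - conductance K \<mu> S)"
    using conductance_nonneg[OF K S \<mu> pos] 
    by (metis ennreal_1 ennreal_add_diff_cancel_right ennreal_minus ennreal_neq_top)
  have tv0: "0 \<le> tv_dist ?\<kappa> ?\<nu>"
    using measure_diff_le_tv_dist[OF \<kappa>(1) \<nu>, of "{}"] by simp
  have "(killed K S ^^ Suc r) (\<lambda>_. 1) y = (killed K S ^^ r) (killed K S (\<lambda>_. 1)) y"
    by (simp add: funpow_swap1)
  also have "\<dots> \<le> (\<integral>\<^sup>+z. killed K S (\<lambda>_. 1) z \<partial>?\<kappa>)"
    by (intro funpow_killed_le_kernel_power[OF K S y] measurable_killed[OF K S]) simp
  also have "\<dots> = (\<integral>\<^sup>+z. ennreal (?g z) \<partial>?\<kappa>)"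
    by (intro nn_integral_cong killed1) (simp add: sets_eq_imp_space_eq[OF \<kappa>(2)])
  also have "\<dots> \<le> (\<integral>\<^sup>+z. ennreal (?g z) \<partial>?\<nu>) + ennreal (tv_dist ?\<kappa> ?\<nu>)"
    using g g1 by (intro nn_integral_le_tv_dist \<kappa> \<nu>)
      (simp_all add: sets \<kappa>(2) measurable_cong_sets[OF \<kappa>(2) refl] sets_eq_imp_space_eq[OF \<kappa>(2)])
  also have "\<dots> = ennreal (1 - conductance K \<mu> S + tv_dist ?\<kappa> ?\<nu>)"
    using le tv0 by (simp add: G)
  also have "\<dots> \<le> ennreal (1 - (conductance K \<mu> S - t))"
    using tv by (intro ennreal_leI) simp
  finally show ?thesis .
qed

section \<open>Repeating rounds of escape attempts\<close>

text \<open>A round consists of \<open>R\<close> steps in which the chain may escape and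
  \<open>m\<close> steps to return to \<open>G\<close>. If \<open>\<sigma>\<close> bounds survival
  of the remaining rounds from \<open>G\<close>, one more round gives
  \<open>(\<sigma> + \<delta>) * (1 - p) + b\<close>, and the additive errors sum like a geometric
  series.\<close>

lemma funpow_killed_iterate:
  fixes p \<delta> b :: real
  assumes K: "markov_kernel M K" and S: "S \<in> sets M" and G: "G \<in> sets M" and W: "W \<in> sets M"
    and GW: "G \<subseteq> W" and WS: "W \<subseteq> S"
    and p: "0 < p" "p \<le> 1" and "0 \<le> \<delta>" and "0 \<le> b"
    and exit: "\<And>y. y \<in> G \<Longrightarrow> (killed K S ^^ R) (\<lambda>_. 1) y \<le> ennreal (1 - p)"
    and stuck: "\<And>w. w \<in> W - G \<Longrightarrow> (killed K (S - G) ^^ m) (\<lambda>_. 1) w \<le> ennreal \<delta>"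
    and bad: "\<And>y. y \<in> G \<Longrightarrow> (killed K S ^^ R) (indicator (S - W)) y \<le> ennreal b"
    and y: "y \<in> G"
  shows "(killed K S ^^ (j * (R + m))) (\<lambda>_. 1) y \<le> ennreal ((1 - p) ^ j + (\<delta> + b) / p)"
  using y
proof (induction j arbitrary: y)
  case 0
  have "1 \<le> ennreal (1 + (\<delta> + b) / p)"
    using assms by (subst ennreal_1[symmetric], intro ennreal_leI) simp
  then show ?case by simp
next
  case (Suc j)
  define \<sigma> where "\<sigma> = (1 - p) ^ j + (\<delta> + b) / p"
  have "0 \<le> \<sigma>" using assms by (simp add: \<sigma>_def)
  have sub: "S \<subseteq> space M" using sets.sets_into_space[OF S] .
  have ysp: "y \<in> space M" "y \<in> S" using Suc.prems GW WS sub by auto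
  \<comment> \<open>The round is cut after \<open>R\<close> steps. Its last \<open>m\<close> steps
    are joined to the following \<open>j\<close> rounds, so that the return bound applies from the
    position at time \<open>R\<close>.\<close>
  have "(killed K S ^^ (Suc j * (R + m))) (\<lambda>_. 1) y =
      (killed K S ^^ R) ((killed K S ^^ (j * (R + m) + m)) (\<lambda>_. 1)) y"
    by (simp flip: funpow_add[unfolded comp_def, THEN fun_cong] add: ac_simps)
  also have "\<dots> \<le> (killed K S ^^ R) (\<lambda>z. ennreal (\<sigma> + \<delta>) + indicator (S - W) z) y"
  proof (rule funpow_killed_mono[OF _ ysp(2)])
    fix z assume z: "z \<in> S"
    show "(killed K S ^^ (j * (R + m) + m)) (\<lambda>_. 1) z \<le> ennreal (\<sigma> + \<delta>) + indicator (S - W) z"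
    proof (cases "z \<in> W")
      case True
      have "(killed K S ^^ (j * (R + m) + m)) (\<lambda>_. 1) z \<le>
          ennreal \<sigma> + indicator (S - G) z * (killed K (S - G) ^^ m) (\<lambda>_. 1) z"
        using Suc.IH GW WS z by (intro funpow_killed_return_bound[OF K S G]) (auto simp: \<sigma>_def)
      also have "\<dots> \<le> ennreal \<sigma> + ennreal \<delta>"
        using stuck[of z] True by (intro add_left_mono) (auto split: split_indicator)
      finally show ?thesis
        using \<open>0 \<le> \<sigma>\<close> \<open>0 \<le> \<delta>\<close> True by simp
    next
      case False
      then show ?thesis
        using z sub by (auto intro!: add_increasing funpow_killed_1_le_1[OF K])
    qed
  qed
  also have "\<dots> = ennreal (\<sigma> + \<delta>) * (killed K S ^^ R) (\<lambda>_. 1) y + (killed K S ^^ R) (indicator (S - W)) y"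
    using S W ysp by (intro funpow_killed_affine[OF K S]) auto
  also have "\<dots> \<le> ennreal (\<sigma> + \<delta>) * ennreal (1 - p) + ennreal b"
    using exit[OF Suc.prems] bad[OF Suc.prems] by (intro add_mono mult_left_mono) auto
  also have "\<dots> = ennreal ((\<sigma> + \<delta>) * (1 - p) + b)"
    using assms \<open>0 \<le> \<sigma>\<close> by (simp add: ennreal_mult)
  also have "\<dots> \<le> ennreal ((1 - p) ^ Suc j + (\<delta> + b) / p)"
  proof (rule ennreal_leI)
    \<comment> \<open>The term \<open>(\<delta> + b) / p\<close> absorbs the new errors: multiplying
      it by \<open>1 - p\<close> frees exactly \<open>\<delta> + b\<close>.\<close>
    have "(\<sigma> + \<delta>) * (1 - p) + b = (1 - p) ^ Suc j + (\<delta> + b) / p - \<delta> * p"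
      using p by (simp add: \<sigma>_def field_simps)
    then show "(\<sigma> + \<delta>) * (1 - p) + b \<le> (1 - p) ^ Suc j + (\<delta> + b) / p"
      using p \<open>0 \<le> \<delta>\<close> by simp
  qed
  finally show ?case .
qed

text \<open>Instantiates the rounds with \<open>Suc r1\<close> steps to escape and
  \<open>nat \<lfloor>r2\<rfloor>\<close> steps to return; the escape probability is the conductance
  minus the mixing error \<open>t\<close>.\<close>

lemma prob_stay_bound:
  fixes M :: "'a measure" and t \<delta> b r2 :: real
  assumes K: "markov_kernel M K" and \<mu>: "\<mu> \<in> space (prob_algebra M)"
    and S: "S \<in> sets M" "0 < measure \<mu> S" and G: "G \<in> sets M" and W: "W \<in> sets M"
    and GW: "G \<subseteq> W" and WS: "W \<subseteq> S"
    and r1: "0 < r1" and r2: "0 \<le> r2"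
    and le1: "conductance K \<mu> S \<le> 1" and t: "0 \<le> t" "t < conductance K \<mu> S"
    and \<delta>: "0 \<le> \<delta>" "\<delta> < 1" and b: "0 \<le> b"
    and mix: "\<And>y. y \<in> G \<Longrightarrow>
      tv_dist (kernel_power M (mh_kernel M K S) r1 y) (uniform_measure \<mu> S) \<le> t"
    and stuck: "\<And>y. y \<in> W - G \<Longrightarrow>
      \<P>(\<omega> in chain_law M K y. hitting_time (G \<union> (space M - S)) \<omega> > ereal r2) \<le> \<delta>"
    and hit: "\<And>y. y \<in> G \<Longrightarrow>
      \<P>(\<omega> in chain_law M K y. hitting_time (space M - W) \<omega>
        < min (ereal (real r1 + r2 + 1)) (hitting_time (space M - S) \<omega>)) \<le> b"
    and x: "x \<in> G"
  shows "\<P>(\<omega> in chain_law M K x. \<forall>i\<le>j * (Suc r1 + nat \<lfloor>r2\<rfloor>). \<omega> i \<in> S) \<le>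
    (1 - (conductance K \<mu> S - t)) ^ j + (\<delta> + 2 * b) / (conductance K \<mu> S - t)"
proof -
  have sub: "S \<subseteq> space M" using sets.sets_into_space[OF S(1)] .
  have xS: "x \<in> S" "x \<in> space M" using x GW WS sub by auto
  let ?p = "conductance K \<mu> S - t" and ?m = "nat \<lfloor>r2\<rfloor>"
  have exit: "(killed K S ^^ Suc r1) (\<lambda>_. 1) y \<le> ennreal (1 - ?p)" if "y \<in> G" for y
    using that GW WS sub le1 by (intro funpow_killed_le_conductance[OF K S(1) \<mu> S(2) _ mix]) auto
  have stuck': "(killed K (S - G) ^^ ?m) (\<lambda>_. 1) w \<le> ennreal \<delta>" if "w \<in> W - G" for w
    using that GW WS r2 stuck by (intro killed_le_never_stuck[OF K S(1) G]) auto
  have hit': "(killed K S ^^ n) (indicator (S - W)) y \<le> ennreal b"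
    if "y \<in> G" "real n < real r1 + r2 + 1" for y n
    using that GW WS by (intro killed_le_never_hit[OF K S(1) W _ _ hit]) auto
  have bad: "(killed K S ^^ Suc r1) (indicator (S - W)) y \<le> ennreal (2 * b)" if y: "y \<in> G" for y
  \<comment> \<open>For \<open>r2 = 0\<close> the assumption \<open>hit\<close> only covers times up to \<open>r1\<close>, but then \<open>stuck\<close> forces
    \<open>W = G\<close>, and \<open>hit\<close> can be applied again to the last step.\<close>
  proof (cases "r2 = 0")
    case False
    then have "(killed K S ^^ Suc r1) (indicator (S - W)) y \<le> ennreal b"
      using r2 by (intro hit'[OF y]) simp
    also have "\<dots> \<le> ennreal (2 * b)" using b by (intro ennreal_leI) simp
    finally show ?thesis .
  next
    case True
    have "W = G"
    proof (rule ccontr)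
      assume "W \<noteq> G"
      with GW obtain w where "w \<in> W - G" by auto
      \<comment> \<open>Zero steps are always survived, so the left side is the value
        \<open>1\<close> of the zeroth iterate.\<close>
      from stuck'[OF this] True have "1 \<le> ennreal \<delta>" by simp
      then show False using \<delta> by (simp add: ennreal_ge_1)
    qed
    have ysp: "y \<in> S" "y \<in> space M" using y GW WS sub by auto
    have "(killed K S ^^ Suc r1) (indicator (S - W)) y =
        (killed K S ^^ r1) (killed K S (indicator (S - W))) y"
      by (simp add: funpow_swap1)
    also have "\<dots> \<le> (killed K S ^^ r1) (\<lambda>z. ennreal b + indicator (S - W) z) y"
    proof (rule funpow_killed_mono[OF _ ysp(1)])
      fix z assume z: "z \<in> S"
      show "killed K S (indicator (S - W)) z \<le> ennreal b + indicator (S - W) z"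
      proof (cases "z \<in> W")
        case True
        \<comment> \<open>Time \<open>1\<close> lies below \<open>real r1 + r2 + 1\<close> because
          \<open>r1\<close> is positive.\<close>
        then show ?thesis
          using hit'[of z 1] r1 r2 \<open>W = G\<close> by auto
      next
        case False
        then show ?thesis
          using z sub by (auto intro!: add_increasing killed_le_1[OF K] split: split_indicator)
      qed
    qed
    also have "\<dots> = ennreal b * (killed K S ^^ r1) (\<lambda>_. 1) y + (killed K S ^^ r1) (indicator (S - W)) y"
      using S W ysp by (intro funpow_killed_affine[OF K S(1)]) auto
    also have "\<dots> \<le> ennreal b * 1 + ennreal b"
      using sub ysp r2 y by (intro add_mono mult_left_mono funpow_killed_1_le_1[OF K] hit') auto
    also have "\<dots> = ennreal (2 * b)"
      using b by (simp flip: ennreal_plus)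
    finally show ?thesis .
  qed
  interpret prob_space "chain_law M K x" by (rule prob_space_chain_law[OF K xS(2)])
  have "ennreal (\<P>(\<omega> in chain_law M K x. \<forall>i\<le>j * (Suc r1 + ?m). \<omega> i \<in> S)) =
      (killed K S ^^ (j * (Suc r1 + ?m))) (\<lambda>_. 1) x"
    by (simp add: emeasure_chain_law_stay[OF K xS(1) S(1)] flip: emeasure_eq_measure)
  also have "\<dots> \<le> ennreal ((1 - ?p) ^ j + (\<delta> + 2 * b) / ?p)"
    using t le1 \<delta> b x
    by (intro funpow_killed_iterate[OF K S(1) G W GW WS _ _ _ _ exit stuck' bad]) auto
  finally show ?thesis
    using t le1 \<delta> b by (subst (asm) ennreal_le_iff) auto
qed

section \<open>Asymptotic estimates\<close>

lemma tendsto_poly_mult_exp_0: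
  fixes a :: real
  assumes "a > 0"
  shows "((\<lambda>\<beta>. poly g \<beta> * exp (- a * \<beta>)) \<longlongrightarrow> 0) at_top"
proof -
  have "((\<lambda>\<beta>. coeff g i * (\<beta> ^ i * exp (- a * \<beta>))) \<longlongrightarrow> coeff g i * 0) at_top" for i
    using assms by (intro tendsto_mult_left) real_asymp
  then have "((\<lambda>\<beta>. \<Sum>i\<le>degree g. coeff g i * (\<beta> ^ i * exp (- a * \<beta>))) \<longlongrightarrow> (\<Sum>i\<le>degree g. coeff g i * 0)) at_top"
    by (intro tendsto_sum)
  then show ?thesis
    by (simp add: poly_altdef sum_distrib_right mult.assoc)
qed

lemma tendsto_polynomially_bounded_mult_exp_0:
  assumes "polynomially_bounded f" and "a > 0"
  shows "((\<lambda>\<beta>. f \<beta> * exp (- a * \<beta>)) \<longlongrightarrow> 0) at_top"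
proof -
  from assms(1) obtain g :: "real poly" and C1 C2
    where f0: "\<And>\<beta>. \<beta> \<ge> 0 \<Longrightarrow> 0 \<le> f \<beta>" and f: "\<And>\<beta>. \<beta> > C1 \<Longrightarrow> f \<beta> \<le> C2 * poly g \<beta>"
    unfolding polynomially_bounded_def by blast
  show ?thesis
  proof (rule tendsto_sandwich[OF _ _ tendsto_const])
    show "\<forall>\<^sub>F \<beta> in at_top. 0 \<le> f \<beta> * exp (- a * \<beta>)"
      using eventually_ge_at_top[of 0] by eventually_elim (simp add: f0)
    show "\<forall>\<^sub>F \<beta> in at_top. f \<beta> * exp (- a * \<beta>) \<le> poly (smult C2 g) \<beta> * exp (- a * \<beta>)"
      using eventually_gt_at_top[of C1] by eventually_elim (simp add: f)
  qed (rule tendsto_poly_mult_exp_0[OF assms(2)])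
qed

text \<open>Removes the logarithms from the event. The extended values do no harm:
  \<open>\<Phi> = 0\<close> makes the quotient \<open>0\<close>, \<open>y = 0\<close> makes it
  \<open>- \<infinity>\<close>, and for \<open>y = \<infinity>\<close> the bound is trivial.\<close>

lemma ereal_ln_quotient_gt_imp:
  assumes gt: "ereal_ln y / ereal_ln (inverse (ereal \<Phi>)) > ereal (1 + \<epsilon>)"
    and \<Phi>: "0 \<le> \<Phi>" "\<Phi> < 1" and \<epsilon>: "\<epsilon> > 0" and y: "y \<ge> 0"
  shows "0 < \<Phi>" and "ereal (\<Phi> powr - (1 + \<epsilon>)) < y"
proof -
  show pos: "0 < \<Phi>"
  proof (rule ccontr)
    assume "\<not> 0 < \<Phi>"
    then have "\<Phi> = 0" using \<Phi> by simp
    then have "ereal_ln (inverse (ereal \<Phi>)) = \<infinity>" by (simp add: ereal_ln_def)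
    with gt \<epsilon> show False by simp
  qed
  have L: "ereal_ln (inverse (ereal \<Phi>)) = ereal (- ln \<Phi>)" "0 < - ln \<Phi>"
    using pos \<Phi> by (simp_all add: ereal_ln_def ln_inverse)
  show "ereal (\<Phi> powr - (1 + \<epsilon>)) < y"
  proof (cases y)
    case (real r)
    have "r > 0"
    proof (rule ccontr)
      assume "\<not> r > 0"
      with real have "ereal_ln y = - \<infinity>" by (simp add: ereal_ln_def)
      with gt L show False by simp
    qed
    then have "ereal_ln y = ereal (ln r)" using real by (simp add: ereal_ln_def)
    with gt L have "1 + \<epsilon> < ln r / (- ln \<Phi>)" by simp
    then have "(1 + \<epsilon>) * - ln \<Phi> < ln r"
      using L(2) by (subst (asm) pos_less_divide_eq)
    then have "exp ((1 + \<epsilon>) * - ln \<Phi>) < r"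
      using \<open>r > 0\<close> by (metis exp_less_cancel_iff exp_ln)
    then show ?thesis
      using pos real by (simp add: powr_def algebra_simps)
  qed (use y in auto)
qed

text \<open>\<open>N\<close> is the length of a round and \<open>j\<close> the number of rounds
  fitting into time \<open>\<Phi> powr - (1 + \<epsilon>)\<close>. Since \<open>p\<close> is at
  least \<open>\<Phi> / 2\<close>, the product \<open>p * j\<close> is of order at least
  \<open>\<Phi> powr - \<epsilon> / N\<close>, and the errors divided by \<open>p\<close> stay
  small.\<close>

lemma geometric_decay_bound:
  fixes \<Phi> \<beta> c \<epsilon> :: real and N :: nat
  defines "p \<equiv> \<Phi> - \<beta> powi (-2) * \<Phi>" and "j \<equiv> nat \<lfloor>\<Phi> powr - (1 + \<epsilon>) / real N\<rfloor>"
  assumes \<Phi>: "0 < \<Phi>" "\<Phi> \<le> exp (- c * \<beta>)" and c: "c > 0" and \<epsilon>: "\<epsilon> > 0" and \<beta>: "\<beta> \<ge> 2" and N: "N > 0"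
  shows "(1 - p) ^ j + (\<beta> powi (-2) * \<Phi> + 2 * \<Phi> ^ 4) / p \<le>
    exp (1/2 - inverse (real N * exp (- (c * \<epsilon>) * \<beta>)) / 2) + 2 * \<beta> powi (-2) + 4 * exp (- c * \<beta>)"
proof -
  have \<Phi>1: "\<Phi> \<le> 1"
    using \<Phi> c \<beta> by (smt (verit) exp_le_one_iff mult_minus_left mult_nonneg_nonneg)
  have q: "0 < \<beta> powi (-2)" "\<beta> powi (-2) \<le> 1/4"
  proof -
    have "2\<^sup>2 \<le> \<beta>\<^sup>2" using \<beta> by (intro power_mono) auto
    then have "inverse (\<beta>\<^sup>2) \<le> inverse 4" by (intro le_imp_inverse_le) auto
    then show "0 < \<beta> powi (-2)" "\<beta> powi (-2) \<le> 1/4"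
      using \<beta> by (simp_all add: power_int_minus)
  qed
  have "\<beta> powi (-2) * \<Phi> \<le> 1/4 * \<Phi>"
    using q \<Phi> by (intro mult_right_mono) auto
  then have p: "\<Phi> / 2 \<le> p" "p \<le> 1"
    using \<Phi> \<Phi>1 q(1) by (auto simp: p_def intro: order_trans[of _ \<Phi>])
  have "(1 - p) ^ j \<le> exp (- p) ^ j"
    using p exp_ge_add_one_self[of "- p"] by (intro power_mono) auto
  also have "\<dots> = exp (- (p * real j))"
    by (simp add: exp_of_nat_mult[symmetric] mult.commute)
  also have "\<dots> \<le> exp (1/2 - inverse (real N * exp (- (c * \<epsilon>) * \<beta>)) / 2)"
  proof -
    have "\<Phi> powr - \<epsilon> \<ge> exp (- c * \<beta>) powr - \<epsilon>"
      using \<Phi> \<epsilon> by (intro powr_mono2') auto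
    also have "exp (- c * \<beta>) powr - \<epsilon> = inverse (exp (- (c * \<epsilon>) * \<beta>))"
      by (simp add: exp_powr_real algebra_simps flip: exp_minus)
    finally have e: "inverse (real N * exp (- (c * \<epsilon>) * \<beta>)) \<le> \<Phi> powr - \<epsilon> / real N"
      using N by (simp add: field_simps)
    \<comment> \<open>Rounding down loses at most one round. After multiplication by
      \<open>\<Phi> / 2\<close> this costs at most \<open>1/2\<close>, the constant in the
      exponent.\<close>
    have "\<Phi> powr - (1 + \<epsilon>) / real N - 1 \<le> real j"
      unfolding j_def by linarith
    then have "\<Phi> / 2 * (\<Phi> powr - (1 + \<epsilon>) / real N - 1) \<le> \<Phi> / 2 * real j"
      using \<Phi> by (intro mult_left_mono) auto
    also have "\<dots> \<le> p * real j"
      using p by (intro mult_right_mono) auto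
    finally have "\<Phi> / 2 * (\<Phi> powr - (1 + \<epsilon>) / real N - 1) \<le> p * real j" .
    moreover have "\<Phi> / 2 * (\<Phi> powr - (1 + \<epsilon>) / real N - 1) = \<Phi> powr - \<epsilon> / real N / 2 - \<Phi> / 2"
    proof -
      have "\<Phi> * \<Phi> powr - (1 + \<epsilon>) = \<Phi> powr - \<epsilon>"
        using \<Phi> by (simp add: powr_mult_base)
      then show ?thesis by (simp add: field_simps)
    qed
    ultimately show ?thesis using e \<Phi>1 by simp
  qed
  finally have 1: "(1 - p) ^ j \<le> exp (1/2 - inverse (real N * exp (- (c * \<epsilon>) * \<beta>)) / 2)" .
  have "(\<beta> powi (-2) * \<Phi> + 2 * \<Phi> ^ 4) / p \<le> (\<beta> powi (-2) * \<Phi> + 2 * \<Phi> ^ 4) / (\<Phi> / 2)"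
    using p \<Phi> q by (intro divide_left_mono) auto
  also have "\<dots> = 2 * \<beta> powi (-2) + 4 * \<Phi> ^ 3"
    using \<Phi> by (simp add: field_simps power_eq_if)
  also have "\<dots> \<le> 2 * \<beta> powi (-2) + 4 * exp (- c * \<beta>)"
    using \<Phi> \<Phi>1 power_decreasing[of 1 3 \<Phi>] by simp
  finally show ?thesis using 1 by simp
qed

section \<open>Assembling the estimates as \<beta> tends to infinity\<close>

theorem lemma3p2:
  fixes \<Omega> S :: "(real ^ 'd) set"
    and Q :: "real \<Rightarrow> real ^ 'd \<Rightarrow> (real ^ 'd) measure"
    and \<pi> :: "real \<Rightarrow> (real ^ 'd) measure"
    and G B W :: "real \<Rightarrow> (real ^ 'd) set"
    and c \<beta>0 :: real
    and r1 :: "real \<Rightarrow> nat" and r2 :: "real \<Rightarrow> real"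
    and x :: "real ^ 'd"
  defines "M \<equiv> restrict_space borel \<Omega>"
  defines "\<Phi> \<equiv> \<lambda>\<beta>. conductance (Q \<beta>) (\<pi> \<beta>) S"
  assumes convex: "convex \<Omega>"
    and pi_prob: "\<And>\<beta>. \<beta> \<ge> 0 \<Longrightarrow> \<pi> \<beta> \<in> space (prob_algebra M)"
    and pi_density: "\<And>\<beta>. \<beta> \<ge> 0 \<Longrightarrow> has_smooth_density \<Omega> (\<pi> \<beta>)"
    and kernel: "\<And>\<beta>. \<beta> \<ge> 0 \<Longrightarrow> markov_kernel M (Q \<beta>)"
    and stationary: "\<And>\<beta>. \<beta> \<ge> 0 \<Longrightarrow> stationary (Q \<beta>) (\<pi> \<beta>)"
    and reversible: "\<And>\<beta>. \<beta> \<ge> 0 \<Longrightarrow> reversible (Q \<beta>) (\<pi> \<beta>)"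
    and ergodic: "\<And>\<beta>. \<beta> \<ge> 0 \<Longrightarrow> ergodic (Q \<beta>) (\<pi> \<beta>)"
    and S: "S \<in> sets M" "(INF \<beta>\<in>{0..}. measure (\<pi> \<beta>) S) > 0"
    and G: "\<And>\<beta>. \<beta> \<ge> 0 \<Longrightarrow> G \<beta> \<in> sets M \<and> G \<beta> \<subseteq> S \<and> G \<beta> \<subseteq> W \<beta>"
    and B: "\<And>\<beta>. \<beta> \<ge> 0 \<Longrightarrow> B \<beta> \<in> sets M \<and> B \<beta> \<subseteq> S \<and> B \<beta> \<subseteq> \<Omega> - W \<beta>"
    and W: "\<And>\<beta>. \<beta> \<ge> 0 \<Longrightarrow> W \<beta> \<in> sets M \<and> W \<beta> \<subseteq> S"
    and c: "c > 0"
    and r1: "polynomially_bounded (\<lambda>\<beta>. real (r1 \<beta>))" "\<And>\<beta>. \<beta> \<ge> 0 \<Longrightarrow> r1 \<beta> > 0"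
    and r2: "polynomially_bounded r2"
    and beta0: "\<beta>0 \<ge> 0"
    and small_conductance: "\<And>\<beta>. \<beta> > \<beta>0 \<Longrightarrow> \<Phi> \<beta> \<le> exp (- c * \<beta>)"
    and rapid_mixing: "\<And>\<beta> y. \<beta> > \<beta>0 \<Longrightarrow> y \<in> G \<beta> \<Longrightarrow>
      tv_dist (kernel_power M (mh_kernel M (Q \<beta>) S) (r1 \<beta>) y) (uniform_measure (\<pi> \<beta>) S)
        \<le> \<beta> powi (-2) * \<Phi> \<beta>"
    and never_stuck: "\<And>\<beta> y. \<beta> > \<beta>0 \<Longrightarrow> y \<in> W \<beta> - G \<beta> \<Longrightarrow>
      \<P>(\<omega> in chain_law M (Q \<beta>) y. hitting_time (G \<beta> \<union> (\<Omega> - S)) \<omega> > ereal (r2 \<beta>))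
        \<le> \<beta> powi (-2) * \<Phi> \<beta>"
    and never_hit: "\<And>\<beta> y. \<beta> > \<beta>0 \<Longrightarrow> y \<in> G \<beta> \<Longrightarrow>
      \<P>(\<omega> in chain_law M (Q \<beta>) y. hitting_time (\<Omega> - W \<beta>) \<omega>
            < min (ereal (real (r1 \<beta>) + r2 \<beta> + 1)) (hitting_time (\<Omega> - S) \<omega>))
        \<le> \<Phi> \<beta> ^ 4"
    and x: "\<forall>\<^sub>F \<beta> in at_top. x \<in> G \<beta>"
  shows "\<forall>\<epsilon>>0.
    ((\<lambda>\<beta>. \<P>(\<omega> in chain_law M (Q \<beta>) x.
        ereal_ln (hitting_time (\<Omega> - S) \<omega>) / ereal_ln (inverse (ereal (\<Phi> \<beta>))) > ereal (1 + \<epsilon>)))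
      \<longlongrightarrow> 0) at_top"
proof (intro allI impI)
  fix \<epsilon> :: real
  assume \<epsilon>: "\<epsilon> > 0"
  have spM: "space M = \<Omega>" by (simp add: M_def space_restrict_space)
  define N where "N \<beta> = Suc (r1 \<beta>) + nat \<lfloor>r2 \<beta>\<rfloor>" for \<beta>
  define P where "P \<beta> = \<P>(\<omega> in chain_law M (Q \<beta>) x. ereal_ln (hitting_time (\<Omega> - S) \<omega>)
    / ereal_ln (inverse (ereal (\<Phi> \<beta>))) > ereal (1 + \<epsilon>))" for \<beta>
  define F where "F \<beta> = exp (1/2 - inverse (real (N \<beta>) * exp (- (c * \<epsilon>) * \<beta>)) / 2)
    + 2 * \<beta> powi (-2) + 4 * exp (- c * \<beta>)" for \<beta>
  have piS: "0 < measure (\<pi> \<beta>) S" if "\<beta> \<ge> 0" for \<beta>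
  proof -
    have "(INF \<beta>\<in>{0..}. measure (\<pi> \<beta>) S) \<le> measure (\<pi> \<beta>) S"
      using that by (intro cINF_lower bdd_belowI2[where m=0]) auto
    with S(2) show ?thesis by simp
  qed
  have r2_nonneg: "0 \<le> r2 \<beta>" if "\<beta> \<ge> 0" for \<beta>
    using r2 that by (simp add: polynomially_bounded_def)
  have P_le: "P \<beta> \<le> F \<beta>" if \<beta>: "\<beta> > \<beta>0" "\<beta> \<ge> 2" "x \<in> G \<beta>" for \<beta>
  proof (cases "\<Phi> \<beta> = 0")
    case True
    \<comment> \<open>The denominator is then \<open>\<infinity>\<close>, and division by \<open>\<infinity>\<close> gives \<open>0\<close>, even for \<open>\<infinity> / \<infinity>\<close>.\<close>
    then have "P \<beta> = 0"
      using \<epsilon> by (simp add: P_def ereal_ln_def)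
    then show ?thesis using \<beta> by (simp add: F_def)
  next
    case False
    have \<beta>0: "\<beta> \<ge> 0" using \<beta> by simp
    note K = kernel[OF \<beta>0] and \<mu> = pi_prob[OF \<beta>0]
    have "0 \<le> \<Phi> \<beta>"
      unfolding \<Phi>_def by (rule conductance_nonneg[OF K S(1) _ piS[OF \<beta>0]]) (use \<mu> in simp)
    with False have \<Phi>: "0 < \<Phi> \<beta>" by simp
    have \<Phi>1: "\<Phi> \<beta> < 1"
      using small_conductance[OF \<beta>(1)] c \<beta>(2) by (smt (verit) exp_less_one_iff mult_minus_left mult_pos_pos)
    define p where "p = \<Phi> \<beta> - \<beta> powi (-2) * \<Phi> \<beta>"
    define j where "j = nat \<lfloor>\<Phi> \<beta> powr - (1 + \<epsilon>) / real (N \<beta>)\<rfloor>"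
    have q: "0 \<le> \<beta> powi (-2)" "\<beta> powi (-2) < 1"
      using \<beta>(2) by (auto simp: power_int_minus inverse_less_1_iff)
    have x_space: "x \<in> space M"
      using G[OF \<beta>0] \<beta>(3) sets.sets_into_space[of "G \<beta>" M] by auto
    let ?P = "chain_law M (Q \<beta>) x"
    interpret prob_space ?P by (rule prob_space_chain_law[OF K x_space])
    note [measurable_cong] = sets_chain_law[OF K x_space]
    note [measurable] = S(1)
    \<comment> \<open>Rounding down ensures that all \<open>j\<close> rounds end by the time that
      the event forces the chain to spend in \<open>S\<close>.\<close>
    have "real j \<le> \<Phi> \<beta> powr - (1 + \<epsilon>) / real (N \<beta>)"
      unfolding j_def using \<Phi> by (intro of_nat_floor) simp
    then have jN: "real (j * N \<beta>) \<le> \<Phi> \<beta> powr - (1 + \<epsilon>)"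
      by (simp add: N_def pos_le_divide_eq algebra_simps)
    have "P \<beta> \<le> \<P>(\<omega> in ?P. \<forall>i\<le>j * N \<beta>. \<omega> i \<in> S)"
      unfolding P_def
    proof (intro finite_measure_mono subsetI CollectI conjI allI impI)
      fix \<omega> i
      assume \<omega>: "\<omega> \<in> {\<omega> \<in> space ?P. ereal_ln (hitting_time (\<Omega> - S) \<omega>)
        / ereal_ln (inverse (ereal (\<Phi> \<beta>))) > ereal (1 + \<epsilon>)}" and i: "i \<le> j * N \<beta>"
      have "0 \<le> hitting_time (\<Omega> - S) \<omega>"
        unfolding hitting_time_def by (intro INF_greatest) simp
      then have gt: "ereal (\<Phi> \<beta> powr - (1 + \<epsilon>)) < hitting_time (\<Omega> - S) \<omega>"
        using ereal_ln_quotient_gt_imp(2)[of \<epsilon> _ "\<Phi> \<beta>"] \<omega> \<Phi> \<Phi>1 \<epsilon> by auto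
      have "\<omega> i \<in> \<Omega>"
        using \<omega> by (auto simp: space_chain_law[OF K x_space] space_PiM PiE_iff spM)
      moreover have "\<omega> i \<notin> \<Omega> - S"
      proof
        assume "\<omega> i \<in> \<Omega> - S"
        then have "ereal (\<Phi> \<beta> powr - (1 + \<epsilon>)) < ereal (real i)"
          using gt by (metis hitting_time_le less_le_trans)
        moreover have "real i \<le> real (j * N \<beta>)"
          using i by (simp only: of_nat_le_iff)
        ultimately show False using jN by simp
      qed
      ultimately show "\<omega> i \<in> S" by simp
    qed (auto, measurable)
    also have "\<dots> \<le> (1 - p) ^ j + (\<beta> powi (-2) * \<Phi> \<beta> + 2 * \<Phi> \<beta> ^ 4) / p"
      unfolding N_def p_def \<Phi>_def
    proof (rule prob_stay_bound[where G="G \<beta>" and W="W \<beta>" and \<mu>="\<pi> \<beta>"])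
      show "\<beta> powi (-2) * conductance (Q \<beta>) (\<pi> \<beta>) S < conductance (Q \<beta>) (\<pi> \<beta>) S"
        using q \<Phi> by (simp add: \<Phi>_def)
      show "\<beta> powi (-2) * conductance (Q \<beta>) (\<pi> \<beta>) S < 1"
        using q \<Phi> \<Phi>1 mult_strict_mono'[of "\<beta> powi (-2)" 1 "\<Phi> \<beta>" 1] by (simp add: \<Phi>_def)
    qed (use K \<mu> S(1) piS[OF \<beta>0] G[OF \<beta>0] W[OF \<beta>0] r1(2)[OF \<beta>0] r2_nonneg[OF \<beta>0] \<Phi> \<Phi>1 q \<beta>
        rapid_mixing[OF \<beta>(1)] never_stuck[OF \<beta>(1)] never_hit[OF \<beta>(1)]
        in \<open>auto simp: \<Phi>_def spM\<close>)
    also have "\<dots> \<le> F \<beta>"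
      unfolding p_def j_def F_def
      using \<Phi> small_conductance[OF \<beta>(1)] c \<epsilon> \<beta>(2) by (intro geometric_decay_bound) (auto simp: N_def)
    finally show ?thesis .
  qed
  have N_tendsto: "((\<lambda>\<beta>. real (N \<beta>) * exp (- (c * \<epsilon>) * \<beta>)) \<longlongrightarrow> 0) at_top"
  proof (rule tendsto_sandwich[OF _ _ tendsto_const])
    have a: "c * \<epsilon> > 0" using c \<epsilon> by simp
    have "((\<lambda>\<beta>. exp (- (c * \<epsilon>) * \<beta>)) \<longlongrightarrow> 0) at_top"
      using tendsto_poly_mult_exp_0[OF a, of 1] by simp
    from tendsto_add[OF this tendsto_add[OF
        tendsto_polynomially_bounded_mult_exp_0[OF r1(1) a] tendsto_polynomially_bounded_mult_exp_0[OF r2 a]]]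
    show "((\<lambda>\<beta>. (1 + real (r1 \<beta>) + r2 \<beta>) * exp (- (c * \<epsilon>) * \<beta>)) \<longlongrightarrow> 0) at_top"
      by (simp add: distrib_right add.assoc)
    show "\<forall>\<^sub>F \<beta> in at_top. real (N \<beta>) * exp (- (c * \<epsilon>) * \<beta>) \<le> (1 + real (r1 \<beta>) + r2 \<beta>) * exp (- (c * \<epsilon>) * \<beta>)"
      using eventually_ge_at_top[of 0]
    proof eventually_elim
      case (elim \<beta>)
      then have "real (N \<beta>) \<le> 1 + real (r1 \<beta>) + r2 \<beta>"
        using r2_nonneg[of \<beta>] of_nat_floor[of "r2 \<beta>"] by (simp add: N_def)
      then show ?case by (intro mult_right_mono) auto
    qed
  qed simp
  have F_tendsto: "(F \<longlongrightarrow> 0) at_top"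
  proof -
    have "LIM \<beta> at_top. inverse (real (N \<beta>) * exp (- (c * \<epsilon>) * \<beta>)) :> at_top"
      using N_tendsto by (rule filterlim_inverse_at_top) (simp add: N_def)
    moreover have "((\<lambda>z::real. exp (1/2 - z / 2)) \<longlongrightarrow> 0) at_top" by real_asymp
    ultimately have 1: "((\<lambda>\<beta>. exp (1/2 - inverse (real (N \<beta>) * exp (- (c * \<epsilon>) * \<beta>)) / 2)) \<longlongrightarrow> 0) at_top"
      by (rule filterlim_compose[rotated])
    have 2: "((\<lambda>\<beta>. 2 * \<beta> powi (-2) + 4 * exp (- c * \<beta>)) \<longlongrightarrow> 0) at_top"
      using c unfolding power_int_minus by simp real_asymp
    from tendsto_add[OF 1 2] show ?thesis
      by (simp add: F_def[abs_def] add.assoc)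
  qed
  have "(P \<longlongrightarrow> 0) at_top"
  proof (rule tendsto_sandwich[OF _ _ tendsto_const F_tendsto])
    show "\<forall>\<^sub>F \<beta> in at_top. 0 \<le> P \<beta>" by (simp add: P_def)
    show "\<forall>\<^sub>F \<beta> in at_top. P \<beta> \<le> F \<beta>"
      using x eventually_gt_at_top[of \<beta>0] eventually_ge_at_top[of 2]
      by eventually_elim (rule P_le)
  qed
  then show "((\<lambda>\<beta>. \<P>(\<omega> in chain_law M (Q \<beta>) x. ereal_ln (hitting_time (\<Omega> - S) \<omega>)
    / ereal_ln (inverse (ereal (\<Phi> \<beta>))) > ereal (1 + \<epsilon>))) \<longlongrightarrow> 0) at_top"
    by (simp only: P_def[abs_def])
qed

end
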